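(* Let $\Theta$ be a compact subset of a separable metric space, let $u\in\mathbb{N}$, and let $H:\Theta\times\mathbb{R}^u\to\mathbb{R}$ be a function such that (i) for each $x\in\mathbb{R}^u$, the map $\theta\mapsto H(\theta,x)$ is continuous on $\Theta$, and (ii) for each $\theta\in\Theta$, the map $x\mapsto H(\theta,x)$ is measurable on $\mathbb{R}^u$. Let $X_1,X_2,\ldots$ be i.i.d. random vectors in $\mathbb{R}^u$. For each $n\in\mathbb{N}$ let $W_{n1},\ldots,W_{nn}$ be real-valued negatively orthant dependent (NOD) random variables, where the random vectors $(W_{n1},\ldots,W_{nn})$, $n\in\mathbb{N}$, are independent across $n$ and are independent of the sequence $(X_1,X_2,\ldots)$. Let $p\in[1,2)$, and let $\alpha>2p$ and $\beta>1$ satisfy $\alpha^{-1}+\beta^{-1}=p^{-1}$. Suppose that $$\mathbb{E}\Big(\sup_{\theta\in\Theta}|H(\theta,X_1)|^{\beta}\Big)<\infty,\qquad \sum_{j=1}^n\mathbb{E}(|W_{nj}|^{\alpha})=O(n),\qquad \sum_{j=1}^n\mathbb{E}(|W_{nj}|)=O(n^{1/p})$$ as $n\to\infty$. Then $$\sup_{\theta\in\Theta}\bigg|\frac{1}{n^{1/p}}\sum_{j=1}^n\Big(W_{nj}H(\theta,X_j)-\mathbb{E}\big(W_{nj}H(\theta,X_j)\big)\Big)\bigg|\longrightarrow 0\quad\text{almost surely as } n\to\infty.$$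
   Context: A finite collection of real-valued random variables $Y_1,\ldots,Y_n$ is negatively orthant dependent (NOD) if for all $y_1,\ldots,y_n\in\mathbb{R}$ both $$\mathbb{P}(Y_1\le y_1,\ldots,Y_n\le y_n)\le\prod_{i=1}^n\mathbb{P}(Y_i\le y_i)\quad\text{and}\quad \mathbb{P}(Y_1>y_1,\ldots,Y_n>y_n)\le\prod_{i=1}^n\mathbb{P}(Y_i>y_i).$$ The weights $W_{nj}$ are not assumed to be identically distributed, exchangeable, or non-negative. All random variables are defined on a common probability space. *)

theory Defs
  imports "HOL-Probability.Probability"
begin

text \<open>Measurability and finiteness of the index set are part of the notion:
  it concerns finite collections of random variables.\<close>

definition (in prob_space) neg_orthant_dep :: "('i \<Rightarrow> 'a \<Rightarrow> real) \<Rightarrow> 'i set \<Rightarrow> bool" where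
  "neg_orthant_dep Y I \<longleftrightarrow>
     finite I \<and> (\<forall>i\<in>I. random_variable borel (Y i)) \<and>
     (\<forall>y :: 'i \<Rightarrow> real.
        \<P>(\<omega> in M. \<forall>i\<in>I. Y i \<omega> \<le> y i) \<le> (\<Prod>i\<in>I. \<P>(\<omega> in M. Y i \<omega> \<le> y i)) \<and>
        \<P>(\<omega> in M. \<forall>i\<in>I. Y i \<omega> > y i) \<le> (\<Prod>i\<in>I. \<P>(\<omega> in M. Y i \<omega> > y i)))"

text \<open>The library predicate \<open>indep_var\<close> requires both random variables to take values in the
  same type. The following is its heterogeneous version; the lemma shows that the two agree
  whenever both apply.\<close>

definition (in prob_space) indep_var_het ::
    "'b measure \<Rightarrow> ('a \<Rightarrow> 'b) \<Rightarrow> 'c measure \<Rightarrow> ('a \<Rightarrow> 'c) \<Rightarrow> bool" where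
  "indep_var_het S Y T Z \<longleftrightarrow>
     random_variable S Y \<and> random_variable T Z \<and>
     indep_set (sigma_sets (space M) {Y -` A \<inter> space M | A. A \<in> sets S})
               (sigma_sets (space M) {Z -` A \<inter> space M | A. A \<in> sets T})"

lemma (in prob_space) indep_var_het_eq_indep_var:
  "indep_var_het S Y T Z \<longleftrightarrow> indep_var S Y T Z"
  by (simp add: indep_var_het_def indep_var_eq)

text \<open>The relation \<open>f n = O(g n)\<close> as \<open>n\<close> tends to infinity, for an extended nonnegative
  sequence \<open>f\<close>. It forces \<open>f n\<close> to be finite for all large \<open>n\<close>. The library relation \<open>f \<in> O(g)\<close>
  is restricted to field-valued functions and so does not apply to moments taken as
  \<open>ennreal\<close>-valued integrals (where a divergent moment is \<open>\<infinity>\<close>, not \<open>0\<close>).\<close>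

definition ennreal_bigo :: "(nat \<Rightarrow> ennreal) \<Rightarrow> (nat \<Rightarrow> real) \<Rightarrow> bool" where
  "ennreal_bigo f g \<longleftrightarrow>
     (\<exists>C::real. \<forall>\<^sub>F n in sequentially. f n \<le> ennreal (C * \<bar>g n\<bar>))"

end

theory Submission
  imports Defs "HOL-Real_Asymp.Real_Asymp"
begin

text \<open>It suffices to treat \<^emph>\<open>nonnegative\<close> weights \<open>V\<^sub>n\<^sub>j\<close> and \<^emph>\<open>nonnegative\<close> independent copies \<open>x\<^sub>j\<close> of one
  variable: negative orthant dependence survives nondecreasing maps and nonincreasing maps, so the
  positive parts of the weights form NOD rows and so do the negative parts, and every function of
  \<open>X\<^sub>j\<close> splits into two nonnegative ones (\<open>strong_law_abs\<close>, \<open>strong_law_signed\<close>).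

  For nonnegative data the products \<open>V\<^sub>n\<^sub>j x\<^sub>j\<close> are again NOD in each row, because freezing the \<open>x\<^sub>j\<close>
  leaves nondecreasing functions of the weights and independence of the \<open>x\<^sub>j\<close> turns the average of
  the product bound into the product of averages (\<open>neg_orthant_dep_indep_transform\<close>). Two
  truncations then suffice. First \<open>x\<^sub>j\<close> is cut at \<open>n powr (1 / \<beta>)\<close>, a level that almost surely is
  eventually not exceeded by \<open>x\<^sub>1, \<dots>, x\<^sub>n\<close>, since the \<open>\<beta>\<close>-th moment is finite. Next the product is
  cut at a small multiple of \<open>n powr (1 / p)\<close>. By Markov's inequality for \<open>\<alpha>\<close>-th moments, the
  probability that the second cut changes row \<open>n\<close> is at most a constant times
  \<open>n powr (1 - \<alpha> / p)\<close> times the \<open>\<alpha>\<close>-th moment of the cut \<open>x\<^sub>1\<close>. Since \<open>1 - \<alpha> / p = - \<alpha> / \<beta>\<close>, this is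
  the expectation of \<open>min (y / n) 1 powr (\<alpha> / \<beta>)\<close> with \<open>y = x\<^sub>1 powr \<beta>\<close>. As \<open>\<alpha> > \<beta>\<close>, the sum over \<open>n\<close>
  is at most a constant times \<open>1 + y\<close> (\<open>sum_min_powr_le\<close>), so exactly the \<open>\<beta>\<close>-th moment is used up and
  the Borel--Cantelli lemma applies. The hypothesis \<open>\<alpha> > 2 p\<close> says \<open>\<beta> < 2 p\<close> and thereby \<open>\<alpha> > \<beta>\<close>; it
  also gives \<open>\<alpha> > 2\<close>, so that the weights have second moments.

  What remains are bounded NOD variables whose second moments add up to at most a constant times
  \<open>n powr \<kappa>\<close> with \<open>\<kappa> < 2 / p\<close>. Product moments of nonnegative NOD variables are at most the products
  of the moments (\<open>neg_orthant_dep_nn_integral_prod_le\<close>, a layer-cake argument), so the classical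
  exponential-moment method gives a Bernstein bound (\<open>neg_orthant_dep_tail_bound\<close>), and the power gap
  between \<open>\<kappa>\<close> and \<open>2 / p\<close> makes the tails of the centred row sums summable. The means
  removed by the truncations are negligible, which proves \<open>weighted_strong_law\<close>.

  Uniformity over the compact set \<open>\<Theta>\<close> comes from a bracketing argument. Near \<open>\<theta>\<^sub>0\<close> the function
  \<open>H \<theta>\<close> differs from \<open>H \<theta>\<^sub>0\<close> by at most its oscillation on a ball, a measurable function whose mean
  at \<open>X\<^sub>1\<close> tends to \<open>0\<close> with the radius by dominated convergence. Applying the strong law to
  \<open>\<bar>W\<^sub>n\<^sub>j\<bar>\<close> and that oscillation bounds the error made by replacing \<open>\<theta>\<close> with \<open>\<theta>\<^sub>0\<close>, up to twice
  the sum of \<open>\<bar>W\<^sub>n\<^sub>j\<bar>\<close> in mean times the small mean oscillation; it is here that the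
  condition on the first absolute moments of the weights enters. Finitely many balls cover \<open>\<Theta>\<close>
  (\<open>uniform_strong_law\<close>).\<close>

section \<open>Negative orthant dependence under monotone maps\<close>

text \<open>An up-set of the line is empty, everything, or a half-line that may be open or closed at its
  end. Realising all of them as pointwise limits of open half-lines lets one limit argument replace
  the case distinction in every coordinate below.\<close>

lemma up_set_limit_of_half_lines:
  fixes U :: "real set"
  assumes up: "\<And>x y. x \<in> U \<Longrightarrow> x \<le> y \<Longrightarrow> y \<in> U"
  shows "\<exists>c::nat \<Rightarrow> real. \<forall>x. \<forall>\<^sub>F k in sequentially. (x > c k) = (x \<in> U)"
proof -
  \<comment> \<open>The end points are \<open>+\<infinity>\<close>, \<open>-\<infinity>\<close> and a real number respectively.\<close>
  consider "U = {}" | "U \<noteq> {}" "\<not> bdd_below U" | "U \<noteq> {}" "bdd_below U" by argo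
  then show ?thesis
  proof cases
    case 1
    have "\<forall>\<^sub>F k in sequentially. (x > real k) = (x \<in> U)" for x
    proof -
      have "\<forall>\<^sub>F k in sequentially. x \<le> real k"
        using filterlim_real_sequentially unfolding filterlim_at_top by blast
      then show ?thesis by eventually_elim (simp add: 1)
    qed
    then show ?thesis by (intro exI[of _ real]) blast
  next
    case 2
    have *: "x \<in> U" for x
    proof -
      obtain u where "u \<in> U" "u < x" using 2(2) unfolding bdd_below_def by (metis not_le)
      then show ?thesis using up[of u x] by simp
    qed
    have "\<forall>\<^sub>F k in sequentially. (x > - real k) = (x \<in> U)" for x
    proof -
      have "\<forall>\<^sub>F k in sequentially. real k > - x"
        using filterlim_real_sequentially unfolding filterlim_at_top_dense by blast
      then show ?thesis by eventually_elim (use * in auto)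
    qed
    then show ?thesis by (intro exI[of _ "\<lambda>k. - real k"]) blast
  next
    case 3
    define c where "c = Inf U"
    have ge: "x \<in> U" if "x > c" for x
    proof -
      obtain u where "u \<in> U" "u < x" using \<open>x > c\<close> 3 by (auto simp: c_def cInf_less_iff)
      then show ?thesis using up[of u x] by simp
    qed
    have le: "c \<le> x" if "x \<in> U" for x unfolding c_def by (rule cInf_lower[OF that 3(2)])
    show ?thesis
    proof (cases "c \<in> U")
      case True
      have "\<forall>\<^sub>F k in sequentially. (x > c - 1 / real (Suc k)) = (x \<in> U)" for x
      proof (cases "x \<ge> c")
        case t: True
        have "x \<in> U" using up[OF True t] .
        moreover have "x > c - 1 / real (Suc k)" for k
        proof -
          have "1 / real (Suc k) > 0" by simp
          then show ?thesis using t by linarith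
        qed
        ultimately show ?thesis by simp
      next
        case False
        then have "x \<notin> U" using le by blast
        have "(\<lambda>k. 1 / real (Suc k)) \<longlonglongrightarrow> 0" by (rule LIMSEQ_Suc[OF lim_1_over_n])
        then have "\<forall>\<^sub>F k in sequentially. 1 / real (Suc k) < c - x"
          using False by (intro order_tendstoD(2)[of _ 0]) auto
        then show ?thesis by eventually_elim (use \<open>x \<notin> U\<close> in auto)
      qed
      then show ?thesis by (intro exI[of _ "\<lambda>k. c - 1 / real (Suc k)"]) blast
    next
      case False
      have "(x > c) = (x \<in> U)" for x using ge le False by (metis le_less)
      then show ?thesis by (intro exI[of _ "\<lambda>_. c"]) simp
    qed
  qed
qed

context prob_space begin

lemma prob_tendsto_of_eventually_eq:
  assumes "\<And>k. {\<omega> \<in> space M. P k \<omega>} \<in> events" "{\<omega> \<in> space M. Q \<omega>} \<in> events"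
    and "\<And>\<omega>. \<omega> \<in> space M \<Longrightarrow> \<forall>\<^sub>F k in sequentially. P k \<omega> = Q \<omega>"
  shows "(\<lambda>k. \<P>(\<omega> in M. P k \<omega>)) \<longlonglongrightarrow> \<P>(\<omega> in M. Q \<omega>)"
proof -
  have "(\<lambda>k. \<integral>\<omega>. indicator {\<omega> \<in> space M. P k \<omega>} \<omega> \<partial>M) \<longlonglongrightarrow>
        (\<integral>\<omega>. (indicator {\<omega> \<in> space M. Q \<omega>} \<omega> :: real) \<partial>M)"
  proof (rule integral_dominated_convergence[where w = "\<lambda>_. 1"])
    show "AE \<omega> in M. (\<lambda>k. indicator {\<omega> \<in> space M. P k \<omega>} \<omega> :: real)
        \<longlonglongrightarrow> indicator {\<omega> \<in> space M. Q \<omega>} \<omega>"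
    proof (rule AE_I2)
      fix \<omega> assume "\<omega> \<in> space M"
      then show "(\<lambda>k. indicator {\<omega> \<in> space M. P k \<omega>} \<omega> :: real)
          \<longlonglongrightarrow> indicator {\<omega> \<in> space M. Q \<omega>} \<omega>"
        by (intro tendsto_eventually eventually_mono[OF assms(3)]) (auto simp: indicator_def)
    qed
  qed (use assms in \<open>auto simp: indicator_def\<close>)
  then show ?thesis using assms by simp
qed

lemma neg_orthant_depD:
  assumes "neg_orthant_dep Y I"
  shows "finite I" "\<And>i. i \<in> I \<Longrightarrow> random_variable borel (Y i)"
    "\<P>(\<omega> in M. \<forall>i\<in>I. Y i \<omega> \<le> y i) \<le> (\<Prod>i\<in>I. \<P>(\<omega> in M. Y i \<omega> \<le> y i))"
    "\<P>(\<omega> in M. \<forall>i\<in>I. Y i \<omega> > y i) \<le> (\<Prod>i\<in>I. \<P>(\<omega> in M. Y i \<omega> > y i))"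
  using assms unfolding neg_orthant_dep_def by auto

text \<open>The defining inequalities speak of open upper and closed lower half-lines; both sides are
  continuous along the approximation of the up-sets by such half-lines.\<close>

lemma neg_orthant_dep_up_sets:
  assumes Y: "neg_orthant_dep Y I"
    and U: "\<And>i. i \<in> I \<Longrightarrow> U i \<in> sets borel"
    and up: "\<And>i x y. i \<in> I \<Longrightarrow> x \<in> U i \<Longrightarrow> x \<le> y \<Longrightarrow> y \<in> U i"
  shows "\<P>(\<omega> in M. \<forall>i\<in>I. Y i \<omega> \<in> U i) \<le> (\<Prod>i\<in>I. \<P>(\<omega> in M. Y i \<omega> \<in> U i))" (is ?upper)
    and "\<P>(\<omega> in M. \<forall>i\<in>I. Y i \<omega> \<notin> U i) \<le> (\<Prod>i\<in>I. \<P>(\<omega> in M. Y i \<omega> \<notin> U i))" (is ?lower)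
proof -
  note fin [simp] = neg_orthant_depD(1)[OF Y] and rv [measurable] = neg_orthant_depD(2)[OF Y]
  note U [measurable]
  have "\<forall>i. \<exists>c::nat \<Rightarrow> real. i \<in> I \<longrightarrow> (\<forall>x. \<forall>\<^sub>F k in sequentially. (x > c k) = (x \<in> U i))"
    using up_set_limit_of_half_lines up by metis
  then obtain c :: "_ \<Rightarrow> nat \<Rightarrow> real"
    where c: "\<And>i x. i \<in> I \<Longrightarrow> \<forall>\<^sub>F k in sequentially. (x > c i k) = (x \<in> U i)"
    by metis
  have ev: "\<forall>\<^sub>F k in sequentially. \<forall>i\<in>I. (x i > c i k) = (x i \<in> U i)" for x
    using c by (intro eventually_ball_finite) auto
  show ?upper
  proof (rule LIMSEQ_le)
    show "(\<lambda>k. \<P>(\<omega> in M. \<forall>i\<in>I. Y i \<omega> > c i k)) \<longlonglongrightarrow> \<P>(\<omega> in M. \<forall>i\<in>I. Y i \<omega> \<in> U i)"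
      by (rule prob_tendsto_of_eventually_eq, measurable)
        (rule eventually_mono[OF ev[of "\<lambda>i. Y i _"]], auto)
    show "(\<lambda>k. \<Prod>i\<in>I. \<P>(\<omega> in M. Y i \<omega> > c i k)) \<longlonglongrightarrow> (\<Prod>i\<in>I. \<P>(\<omega> in M. Y i \<omega> \<in> U i))"
      by (intro tendsto_prod prob_tendsto_of_eventually_eq c) measurable
  qed (use neg_orthant_depD(4)[OF Y] in auto)
  show ?lower
  proof (rule LIMSEQ_le)
    show "(\<lambda>k. \<P>(\<omega> in M. \<forall>i\<in>I. Y i \<omega> \<le> c i k)) \<longlonglongrightarrow> \<P>(\<omega> in M. \<forall>i\<in>I. Y i \<omega> \<notin> U i)"
      by (rule prob_tendsto_of_eventually_eq, measurable)
        (rule eventually_mono[OF ev[of "\<lambda>i. Y i _"]], auto simp: not_less[symmetric])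
    show "(\<lambda>k. \<Prod>i\<in>I. \<P>(\<omega> in M. Y i \<omega> \<le> c i k)) \<longlonglongrightarrow> (\<Prod>i\<in>I. \<P>(\<omega> in M. Y i \<omega> \<notin> U i))"
      by (intro tendsto_prod prob_tendsto_of_eventually_eq, measurable)
        (rule eventually_mono[OF c], auto simp: not_less[symmetric])
  qed (use neg_orthant_depD(3)[OF Y] in auto)
qed

text \<open>A nondecreasing map pulls an open upper half-line back to an up-set, which need not be an open
  half-line.\<close>

lemma neg_orthant_dep_mono:
  assumes Y: "neg_orthant_dep Y I"
    and f: "\<And>i. i \<in> I \<Longrightarrow> mono (f i)" "\<And>i. i \<in> I \<Longrightarrow> f i \<in> borel_measurable borel"
  shows "neg_orthant_dep (\<lambda>i \<omega>. f i (Y i \<omega>)) I"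
  unfolding neg_orthant_dep_def
proof (intro conjI allI ballI)
  show "finite I" by (rule neg_orthant_depD(1)[OF Y])
  show "random_variable borel (\<lambda>\<omega>. f i (Y i \<omega>))" if "i \<in> I" for i
    by (rule measurable_compose[OF neg_orthant_depD(2)[OF Y that] f(2)[OF that]])
  fix y :: "_ \<Rightarrow> real"
  define U where "U = (\<lambda>i. {x. f i x > y i})"
  have U: "U i \<in> sets borel" if "i \<in> I" for i
    using measurable_sets[OF f(2)[OF that], of "{y i<..}"] by (simp add: U_def vimage_def)
  have up: "x' \<in> U i" if "i \<in> I" "x \<in> U i" "x \<le> x'" for i x x'
    using that monoD[OF f(1)[OF that(1)] that(3)] by (auto simp: U_def)
  note * = neg_orthant_dep_up_sets[OF Y U up]
  show "\<P>(\<omega> in M. \<forall>i\<in>I. f i (Y i \<omega>) \<le> y i) \<le> (\<Prod>i\<in>I. \<P>(\<omega> in M. f i (Y i \<omega>) \<le> y i))"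
    using *(2) by (simp add: U_def not_less)
  show "\<P>(\<omega> in M. \<forall>i\<in>I. f i (Y i \<omega>) > y i) \<le> (\<Prod>i\<in>I. \<P>(\<omega> in M. f i (Y i \<omega>) > y i))"
    using *(1) by (simp add: U_def)
qed

text \<open>A nonincreasing map interchanges the roles of the two orthant inequalities.\<close>

lemma neg_orthant_dep_antimono:
  assumes Y: "neg_orthant_dep Y I"
    and f: "\<And>i. i \<in> I \<Longrightarrow> antimono (f i)" "\<And>i. i \<in> I \<Longrightarrow> f i \<in> borel_measurable borel"
  shows "neg_orthant_dep (\<lambda>i \<omega>. f i (Y i \<omega>)) I"
  unfolding neg_orthant_dep_def
proof (intro conjI allI ballI)
  show "finite I" by (rule neg_orthant_depD(1)[OF Y])
  show "random_variable borel (\<lambda>\<omega>. f i (Y i \<omega>))" if "i \<in> I" for i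
    by (rule measurable_compose[OF neg_orthant_depD(2)[OF Y that] f(2)[OF that]])
  fix y :: "_ \<Rightarrow> real"
  define U where "U = (\<lambda>i. {x. f i x \<le> y i})"
  have U: "U i \<in> sets borel" if "i \<in> I" for i
    using measurable_sets[OF f(2)[OF that], of "{..y i}"] by (simp add: U_def vimage_def)
  have up: "x' \<in> U i" if "i \<in> I" "x \<in> U i" "x \<le> x'" for i x x'
    using that antimonoD[OF f(1)[OF that(1)] that(3)] by (auto simp: U_def)
  note * = neg_orthant_dep_up_sets[OF Y U up]
  show "\<P>(\<omega> in M. \<forall>i\<in>I. f i (Y i \<omega>) \<le> y i) \<le> (\<Prod>i\<in>I. \<P>(\<omega> in M. f i (Y i \<omega>) \<le> y i))"
    using *(1) by (simp add: U_def)
  show "\<P>(\<omega> in M. \<forall>i\<in>I. f i (Y i \<omega>) > y i) \<le> (\<Prod>i\<in>I. \<P>(\<omega> in M. f i (Y i \<omega>) > y i))"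
    using *(2) by (simp add: U_def not_le)
qed


section \<open>Product moments\<close>

text \<open>Layer-cake: each factor is the Lebesgue measure of the levels it exceeds, so the product is an
  integral over level vectors of the indicator of an upper orthant event. The upper orthant
  inequality holds for each level vector, and integrating it back gives the product of the means.\<close>

lemma neg_orthant_dep_nn_integral_prod_le:
  assumes Y: "neg_orthant_dep Y I"
    and nonneg: "\<And>i \<omega>. i \<in> I \<Longrightarrow> \<omega> \<in> space M \<Longrightarrow> 0 \<le> Y i \<omega>"
  shows "(\<integral>\<^sup>+\<omega>. (\<Prod>i\<in>I. ennreal (Y i \<omega>)) \<partial>M) \<le> (\<Prod>i\<in>I. \<integral>\<^sup>+\<omega>. ennreal (Y i \<omega>) \<partial>M)"
proof -
  note fin [simp] = neg_orthant_depD(1)[OF Y] and rv [measurable] = neg_orthant_depD(2)[OF Y]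
  interpret P: product_sigma_finite "\<lambda>_. lborel :: real measure" ..
  interpret S: sigma_finite_measure "Pi\<^sub>M I (\<lambda>_. lborel :: real measure)"
    by (rule P.sigma_finite) simp
  interpret MP: pair_sigma_finite M "Pi\<^sub>M I (\<lambda>_. lborel :: real measure)" ..
  interpret MR: pair_sigma_finite M "lborel :: real measure" ..
  \<comment> \<open>Levels start at \<open>0\<close>, so that the set of levels below \<open>Y i \<omega>\<close> has measure \<open>Y i \<omega>\<close>.\<close>
  define K :: "_ \<Rightarrow> real \<Rightarrow> _ \<Rightarrow> ennreal"
    where "K = (\<lambda>i s \<omega>. if 0 \<le> s \<and> s < Y i \<omega> then 1 else 0)"
  have layer: "ennreal (Y i \<omega>) = (\<integral>\<^sup>+s. K i s \<omega> \<partial>lborel)" if "i \<in> I" "\<omega> \<in> space M" for i \<omega>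
  proof -
    have "(\<integral>\<^sup>+s. K i s \<omega> \<partial>lborel) = (\<integral>\<^sup>+s. indicator {0..<Y i \<omega>} s \<partial>lborel)"
      by (intro nn_integral_cong) (auto simp: K_def indicator_def)
    then show ?thesis using nonneg[OF that] by simp
  qed
  have K1 [measurable]: "(\<lambda>(\<omega>, s). K i s \<omega>) \<in> borel_measurable (M \<Otimes>\<^sub>M lborel)" if "i \<in> I" for i
    using that unfolding K_def by measurable
  have K2 [measurable]: "(\<lambda>s. K i s \<omega>) \<in> borel_measurable lborel" for i \<omega>
    unfolding K_def by measurable
  have K3 [measurable]: "(\<lambda>\<omega>. K i s \<omega>) \<in> borel_measurable M" if "i \<in> I" for i s
    using that unfolding K_def by measurable
  have "(\<integral>\<^sup>+\<omega>. (\<Prod>i\<in>I. ennreal (Y i \<omega>)) \<partial>M) = (\<integral>\<^sup>+\<omega>. (\<Prod>i\<in>I. \<integral>\<^sup>+s. K i s \<omega> \<partial>lborel) \<partial>M)"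
    by (intro nn_integral_cong prod.cong refl layer)
  also have "\<dots> = (\<integral>\<^sup>+\<omega>. (\<integral>\<^sup>+s. (\<Prod>i\<in>I. K i (s i) \<omega>) \<partial>Pi\<^sub>M I (\<lambda>_. lborel)) \<partial>M)"
    by (intro nn_integral_cong P.product_nn_integral_prod[symmetric]) auto
  also have "\<dots> = (\<integral>\<^sup>+s. (\<integral>\<^sup>+\<omega>. (\<Prod>i\<in>I. K i (s i) \<omega>) \<partial>M) \<partial>Pi\<^sub>M I (\<lambda>_. lborel))"
    by (rule MP.Fubini'[symmetric]) (unfold K_def, measurable)
  also have "\<dots> \<le> (\<integral>\<^sup>+s. (\<Prod>i\<in>I. \<integral>\<^sup>+\<omega>. K i (s i) \<omega> \<partial>M) \<partial>Pi\<^sub>M I (\<lambda>_. lborel))"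
  proof (intro nn_integral_mono)
    fix s :: "_ \<Rightarrow> real"
    show "(\<integral>\<^sup>+\<omega>. (\<Prod>i\<in>I. K i (s i) \<omega>) \<partial>M) \<le> (\<Prod>i\<in>I. \<integral>\<^sup>+\<omega>. K i (s i) \<omega> \<partial>M)"
    proof (cases "\<forall>i\<in>I. 0 \<le> s i")
      case True
      have "(\<integral>\<^sup>+\<omega>. (\<Prod>i\<in>I. K i (s i) \<omega>) \<partial>M) =
          (\<integral>\<^sup>+\<omega>. indicator {\<omega> \<in> space M. \<forall>i\<in>I. Y i \<omega> > s i} \<omega> \<partial>M)"
        using True by (intro nn_integral_cong) (auto simp: K_def indicator_def)
      also have "\<dots> = ennreal \<P>(\<omega> in M. \<forall>i\<in>I. Y i \<omega> > s i)"
        by (subst nn_integral_indicator) (auto simp: emeasure_eq_measure)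
      also have "\<dots> \<le> ennreal (\<Prod>i\<in>I. \<P>(\<omega> in M. Y i \<omega> > s i))"
        by (intro ennreal_leI neg_orthant_depD(4)[OF Y])
      also have "\<dots> = (\<Prod>i\<in>I. ennreal \<P>(\<omega> in M. Y i \<omega> > s i))"
        by (rule prod_ennreal[symmetric]) simp
      also have "\<dots> = (\<Prod>i\<in>I. \<integral>\<^sup>+\<omega>. K i (s i) \<omega> \<partial>M)"
      proof (intro prod.cong refl)
        fix i assume i: "i \<in> I"
        have "(\<integral>\<^sup>+\<omega>. K i (s i) \<omega> \<partial>M) = (\<integral>\<^sup>+\<omega>. indicator {\<omega> \<in> space M. Y i \<omega> > s i} \<omega> \<partial>M)"
          using True i by (intro nn_integral_cong) (auto simp: K_def indicator_def)
        also have "\<dots> = ennreal \<P>(\<omega> in M. Y i \<omega> > s i)"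
          using i by (subst nn_integral_indicator) (auto simp: emeasure_eq_measure)
        finally show "ennreal \<P>(\<omega> in M. Y i \<omega> > s i) = (\<integral>\<^sup>+\<omega>. K i (s i) \<omega> \<partial>M)" ..
      qed
      finally show ?thesis .
    next
      case False
      then obtain i where i: "i \<in> I" "s i < 0" by force
      have "(\<lambda>\<omega>. \<Prod>i\<in>I. K i (s i) \<omega>) = (\<lambda>_. 0)"
        using i fin by (intro ext prod_zero bexI[of _ i]) (auto simp: K_def)
      then show ?thesis by simp
    qed
  qed
  also have "\<dots> = (\<Prod>i\<in>I. \<integral>\<^sup>+s. (\<integral>\<^sup>+\<omega>. K i s \<omega> \<partial>M) \<partial>lborel)"
    by (rule P.product_nn_integral_prod) (unfold K_def, measurable)
  also have "\<dots> = (\<Prod>i\<in>I. \<integral>\<^sup>+\<omega>. ennreal (Y i \<omega>) \<partial>M)"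
  proof (intro prod.cong refl)
    fix i assume i: "i \<in> I"
    have "(\<integral>\<^sup>+s. (\<integral>\<^sup>+\<omega>. K i s \<omega> \<partial>M) \<partial>lborel) = (\<integral>\<^sup>+\<omega>. (\<integral>\<^sup>+s. K i s \<omega> \<partial>lborel) \<partial>M)"
      by (rule MR.Fubini') (rule K1[OF i])
    also have "\<dots> = (\<integral>\<^sup>+\<omega>. ennreal (Y i \<omega>) \<partial>M)"
      by (intro nn_integral_cong) (simp add: layer i)
    finally show "(\<integral>\<^sup>+s. (\<integral>\<^sup>+\<omega>. K i s \<omega> \<partial>M) \<partial>lborel) = (\<integral>\<^sup>+\<omega>. ennreal (Y i \<omega>) \<partial>M)" .
  qed
  finally show ?thesis .
qed

section \<open>Mixing with independent factors\<close>

text \<open>Conditioning on an independent variable amounts to freezing its value.\<close>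

lemma emeasure_indep_var_disintegrate:
  assumes ind: "indep_var S X T W" and A: "A \<in> sets (S \<Otimes>\<^sub>M T)"
  shows "emeasure M {\<omega> \<in> space M. (X \<omega>, W \<omega>) \<in> A} =
    (\<integral>\<^sup>+x. emeasure M {\<omega> \<in> space M. (x, W \<omega>) \<in> A} \<partial>distr M S X)"
proof -
  note [measurable] = indep_var_rv1[OF ind] indep_var_rv2[OF ind] A
  interpret D: prob_space "distr M T W" by (rule prob_space_distr) measurable
  have "emeasure M {\<omega> \<in> space M. (X \<omega>, W \<omega>) \<in> A} = emeasure (distr M (S \<Otimes>\<^sub>M T) (\<lambda>\<omega>. (X \<omega>, W \<omega>))) A"
    by (subst emeasure_distr) (auto simp: vimage_def Int_def conj_commute)
  also have "\<dots> = emeasure (distr M S X \<Otimes>\<^sub>M distr M T W) A"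
    using ind by (simp add: indep_var_distribution_eq)
  also have "\<dots> = (\<integral>\<^sup>+x. emeasure (distr M T W) (Pair x -` A) \<partial>distr M S X)"
    by (rule D.emeasure_pair_measure_alt) simp
  also have "\<dots> = (\<integral>\<^sup>+x. emeasure M {\<omega> \<in> space M. (x, W \<omega>) \<in> A} \<partial>distr M S X)"
    by (intro nn_integral_cong, subst emeasure_distr)
      (use sets_Pair1[OF A] in \<open>auto simp: vimage_def Int_def conj_commute\<close>)
  finally show ?thesis .
qed

text \<open>Suppose the product bound holds whenever the independent coordinates \<open>X i\<close> are frozen. Averaging it
  over their joint law, which is a product measure, turns the right-hand side into a product of
  one-coordinate averages, so the bound persists for the random \<open>X i\<close>.\<close>

lemma prob_orthant_le_prod_of_indep_mixing:
  fixes X :: "'i \<Rightarrow> 'a \<Rightarrow> real" and W :: "'i \<Rightarrow> 'a \<Rightarrow> real"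
  assumes fin: "finite I" "I \<noteq> {}"
    and X: "indep_vars (\<lambda>_. borel) X I"
    and XW: "indep_var (Pi\<^sub>M I (\<lambda>_. borel)) (\<lambda>\<omega>. \<lambda>i\<in>I. X i \<omega>) (Pi\<^sub>M I (\<lambda>_. borel)) (\<lambda>\<omega>. \<lambda>i\<in>I. W i \<omega>)"
    and A: "\<And>i. i \<in> I \<Longrightarrow> A i \<in> sets (borel \<Otimes>\<^sub>M borel)"
    and le: "\<And>x. \<P>(\<omega> in M. \<forall>i\<in>I. (x i, W i \<omega>) \<in> A i) \<le> (\<Prod>i\<in>I. \<P>(\<omega> in M. (x i, W i \<omega>) \<in> A i))"
  shows "\<P>(\<omega> in M. \<forall>i\<in>I. (X i \<omega>, W i \<omega>) \<in> A i) \<le> (\<Prod>i\<in>I. \<P>(\<omega> in M. (X i \<omega>, W i \<omega>) \<in> A i))"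
proof -
  let ?N = "Pi\<^sub>M I (\<lambda>_. borel :: real measure)"
  have rvX [measurable]: "random_variable borel (X i)" if "i \<in> I" for i
    using X that by (auto simp: indep_vars_def)
  have rvW [measurable]: "random_variable borel (W i)" if "i \<in> I" for i
    using measurable_compose[OF indep_var_rv2[OF XW] measurable_component_singleton[OF that]] that
    by simp
  note A [measurable]
  define \<mu> where "\<mu> = (\<lambda>i. distr M borel (X i))"
  have \<mu>: "prob_space (\<mu> i)" if "i \<in> I" for i
    unfolding \<mu>_def using that by (intro prob_space_distr) measurable
  \<comment> \<open>The locale for products wants a probability measure at every index, also outside \<open>I\<close>.\<close>
  define \<nu> where "\<nu> = (\<lambda>i. if i \<in> I then \<mu> i else return borel 0)"
  interpret P: product_prob_space \<nu>
    using \<mu> by (intro product_prob_spaceI) (auto simp: \<nu>_def intro: prob_space_return)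
  have dX: "distr M ?N (\<lambda>\<omega>. \<lambda>i\<in>I. X i \<omega>) = Pi\<^sub>M I \<nu>"
  proof -
    have "distr M ?N (\<lambda>\<omega>. \<lambda>i\<in>I. X i \<omega>) = Pi\<^sub>M I \<mu>"
      using X indep_vars_iff_distr_eq_PiM'[where X = X and M' = "\<lambda>_. borel", OF fin(2) rvX]
      by (simp add: \<mu>_def)
    also have "\<dots> = Pi\<^sub>M I \<nu>" by (intro PiM_cong) (auto simp: \<nu>_def)
    finally show ?thesis .
  qed
  define g where "g = (\<lambda>i x. emeasure M {\<omega> \<in> space M. (x, W i \<omega>) \<in> A i})"
  have gm: "g i \<in> borel_measurable (\<nu> i)" if "i \<in> I" for i
  proof -
    have "g i = (\<lambda>x. \<integral>\<^sup>+\<omega>. indicator (A i) (x, W i \<omega>) \<partial>M)"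
    proof
      fix x
      have "(\<integral>\<^sup>+\<omega>. indicator (A i) (x, W i \<omega>) \<partial>M) =
          (\<integral>\<^sup>+\<omega>. indicator {\<omega> \<in> space M. (x, W i \<omega>) \<in> A i} \<omega> \<partial>M)"
        by (intro nn_integral_cong) (auto simp: indicator_def)
      also have "\<dots> = g i x"
        unfolding g_def using that by (subst nn_integral_indicator) auto
      finally show "g i x = (\<integral>\<^sup>+\<omega>. indicator (A i) (x, W i \<omega>) \<partial>M)" ..
    qed
    moreover have "\<dots> \<in> borel_measurable borel" using that by measurable
    ultimately have "g i \<in> borel_measurable borel" by simp
    then show ?thesis
      using that by (simp add: \<nu>_def \<mu>_def cong: measurable_cong_sets)
  qed
  have single: "emeasure M {\<omega> \<in> space M. (X i \<omega>, W i \<omega>) \<in> A i} = (\<integral>\<^sup>+x. g i x \<partial>\<nu> i)"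
    if "i \<in> I" for i
  proof -
    have "indep_var borel ((\<lambda>f. f i) \<circ> (\<lambda>\<omega>. \<lambda>i\<in>I. X i \<omega>)) borel ((\<lambda>f. f i) \<circ> (\<lambda>\<omega>. \<lambda>i\<in>I. W i \<omega>))"
      by (rule indep_var_compose[OF XW]) (use that in measurable)
    then have "indep_var borel (X i) borel (W i)"
      using that by (simp add: comp_def)
    from emeasure_indep_var_disintegrate[OF this A[OF that]] show ?thesis
      using that by (simp add: g_def \<nu>_def \<mu>_def)
  qed
  define B where "B = {z \<in> space (?N \<Otimes>\<^sub>M ?N). \<forall>i\<in>I. (fst z i, snd z i) \<in> A i}"
  have B: "B \<in> sets (?N \<Otimes>\<^sub>M ?N)" unfolding B_def using fin by measurable
  have "emeasure M {\<omega> \<in> space M. \<forall>i\<in>I. (X i \<omega>, W i \<omega>) \<in> A i} =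
      emeasure M {\<omega> \<in> space M. ((\<lambda>i\<in>I. X i \<omega>), (\<lambda>i\<in>I. W i \<omega>)) \<in> B}"
    by (intro arg_cong2[where f = emeasure])
      (auto simp: B_def space_pair_measure space_PiM)
  also have "\<dots> = (\<integral>\<^sup>+x. emeasure M {\<omega> \<in> space M. (x, (\<lambda>i\<in>I. W i \<omega>)) \<in> B} \<partial>Pi\<^sub>M I \<nu>)"
    unfolding dX[symmetric] by (rule emeasure_indep_var_disintegrate[OF XW B])
  also have "\<dots> \<le> (\<integral>\<^sup>+x. (\<Prod>i\<in>I. g i (x i)) \<partial>Pi\<^sub>M I \<nu>)"
  proof (rule nn_integral_mono)
    fix x
    have "emeasure M {\<omega> \<in> space M. (x, (\<lambda>i\<in>I. W i \<omega>)) \<in> B} \<le>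
        emeasure M {\<omega> \<in> space M. \<forall>i\<in>I. (x i, W i \<omega>) \<in> A i}"
      using fin by (intro emeasure_mono) (auto simp: B_def)
    also have "\<dots> \<le> ennreal (\<Prod>i\<in>I. \<P>(\<omega> in M. (x i, W i \<omega>) \<in> A i))"
      unfolding emeasure_eq_measure by (rule ennreal_leI[OF le])
    also have "\<dots> = (\<Prod>i\<in>I. ennreal \<P>(\<omega> in M. (x i, W i \<omega>) \<in> A i))"
      by (rule prod_ennreal[symmetric]) simp
    finally show "emeasure M {\<omega> \<in> space M. (x, (\<lambda>i\<in>I. W i \<omega>)) \<in> B} \<le> (\<Prod>i\<in>I. g i (x i))"
      by (simp add: g_def emeasure_eq_measure)
  qed
  also have "\<dots> = (\<Prod>i\<in>I. \<integral>\<^sup>+x. g i x \<partial>\<nu> i)"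
    by (rule P.product_nn_integral_prod) (use fin gm in auto)
  also have "\<dots> = (\<Prod>i\<in>I. ennreal \<P>(\<omega> in M. (X i \<omega>, W i \<omega>) \<in> A i))"
    by (intro prod.cong refl) (simp add: single[symmetric] emeasure_eq_measure)
  also have "\<dots> = ennreal (\<Prod>i\<in>I. \<P>(\<omega> in M. (X i \<omega>, W i \<omega>) \<in> A i))"
    by (rule prod_ennreal) simp
  finally show ?thesis
    unfolding emeasure_eq_measure by (subst (asm) ennreal_le_iff) (auto intro: prod_nonneg)
qed

text \<open>Frozen values of \<open>X\<close> leave nondecreasing functions of the weights. The case of interest is
  truncated products of NOD weights with nonnegative independent factors.\<close>

lemma neg_orthant_dep_indep_transform:
  fixes X :: "'i \<Rightarrow> 'a \<Rightarrow> real" and W :: "'i \<Rightarrow> 'a \<Rightarrow> real"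
  assumes W: "neg_orthant_dep W I"
    and X: "indep_vars (\<lambda>_. borel) X I"
    and XW: "indep_var (Pi\<^sub>M I (\<lambda>_. borel)) (\<lambda>\<omega>. \<lambda>i\<in>I. X i \<omega>) (Pi\<^sub>M I (\<lambda>_. borel)) (\<lambda>\<omega>. \<lambda>i\<in>I. W i \<omega>)"
    and \<phi>: "\<And>x. mono (\<phi> x)" "(\<lambda>(x, w). \<phi> x w) \<in> borel_measurable (borel \<Otimes>\<^sub>M borel)"
  shows "neg_orthant_dep (\<lambda>i \<omega>. \<phi> (X i \<omega>) (W i \<omega>) :: real) I"
proof (cases "I = {}")
  case True
  then show ?thesis by (simp add: neg_orthant_dep_def prob_space)
next
  case False
  note fin = neg_orthant_depD(1)[OF W] and rvW [measurable] = neg_orthant_depD(2)[OF W]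
  have rvX [measurable]: "random_variable borel (X i)" if "i \<in> I" for i
    using X that by (auto simp: indep_vars_def)
  have \<phi>x: "neg_orthant_dep (\<lambda>i \<omega>. \<phi> (x i) (W i \<omega>)) I" for x
  proof (rule neg_orthant_dep_mono[OF W \<phi>(1)])
    fix i
    have "(\<lambda>w. (x i, w)) \<in> borel \<rightarrow>\<^sub>M borel \<Otimes>\<^sub>M borel" by measurable
    from measurable_compose[OF this \<phi>(2)] show "\<phi> (x i) \<in> borel_measurable borel" by simp
  qed
  have meas: "{z. \<phi> (fst z) (snd z) \<le> c} \<in> sets (borel \<Otimes>\<^sub>M borel)"
      "{z. \<phi> (fst z) (snd z) > c} \<in> sets (borel \<Otimes>\<^sub>M borel)" for c
    using measurable_sets[OF \<phi>(2), of "{..c}"] measurable_sets[OF \<phi>(2), of "{c<..}"]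
    by (simp_all add: vimage_def space_pair_measure case_prod_beta)
  show ?thesis
    unfolding neg_orthant_dep_def
  proof (intro conjI allI ballI fin)
    show "random_variable borel (\<lambda>\<omega>. \<phi> (X i \<omega>) (W i \<omega>))" if "i \<in> I" for i
    proof -
      have "(\<lambda>\<omega>. (X i \<omega>, W i \<omega>)) \<in> M \<rightarrow>\<^sub>M borel \<Otimes>\<^sub>M borel" using that by measurable
      from measurable_compose[OF this \<phi>(2)] show ?thesis by simp
    qed
    fix y :: "'i \<Rightarrow> real"
    show "\<P>(\<omega> in M. \<forall>i\<in>I. \<phi> (X i \<omega>) (W i \<omega>) \<le> y i) \<le> (\<Prod>i\<in>I. \<P>(\<omega> in M. \<phi> (X i \<omega>) (W i \<omega>) \<le> y i))"
      using prob_orthant_le_prod_of_indep_mixing[OF fin False X XW,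
          of "\<lambda>i. {z. \<phi> (fst z) (snd z) \<le> y i}", OF meas(1)] neg_orthant_depD(3)[OF \<phi>x]
      by simp
    show "\<P>(\<omega> in M. \<forall>i\<in>I. \<phi> (X i \<omega>) (W i \<omega>) > y i) \<le> (\<Prod>i\<in>I. \<P>(\<omega> in M. \<phi> (X i \<omega>) (W i \<omega>) > y i))"
      using prob_orthant_le_prod_of_indep_mixing[OF fin False X XW,
          of "\<lambda>i. {z. \<phi> (fst z) (snd z) > y i}", OF meas(2)] neg_orthant_depD(4)[OF \<phi>x]
      by simp
  qed
qed

end

section \<open>A Bernstein inequality\<close>

lemma exp_le_quadratic:
  fixes u c :: real
  assumes "\<bar>u\<bar> \<le> c"
  shows "exp u \<le> 1 + u + exp c * u\<^sup>2 / 2"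
proof -
  obtain t where t: "\<bar>t\<bar> \<le> \<bar>u\<bar>" "exp u = (\<Sum>m<2. u ^ m / fact m) + exp t / fact 2 * u ^ 2"
    using Maclaurin_exp_le[of u 2] by blast
  have "exp t \<le> exp c" using t(1) assms by simp
  then have "exp t * u\<^sup>2 \<le> exp c * u\<^sup>2" by (rule mult_right_mono) simp
  then show ?thesis using t(2) by (simp add: numeral_2_eq_2)
qed

context prob_space begin

text \<open>Bernstein's method needs independence only to factor the exponential moment, and for NOD
  variables the factorisation holds as an inequality.\<close>

lemma neg_orthant_dep_upper_tail_bound:
  assumes Y: "neg_orthant_dep Y I"
    and bd: "\<And>i \<omega>. i \<in> I \<Longrightarrow> \<omega> \<in> space M \<Longrightarrow> \<bar>Y i \<omega>\<bar> \<le> b"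
    and B: "(\<Sum>i\<in>I. expectation (\<lambda>\<omega>. (Y i \<omega>)\<^sup>2)) \<le> B"
    and t: "t > 0"
  shows "\<P>(\<omega> in M. (\<Sum>i\<in>I. Y i \<omega> - expectation (Y i)) \<ge> r) \<le> exp (t\<^sup>2 * exp (t * b) * B / 2 - t * r)"
proof -
  note fin [simp] = neg_orthant_depD(1)[OF Y] and rv [measurable] = neg_orthant_depD(2)[OF Y]
  have int_Y: "integrable M (Y i)" if "i \<in> I" for i
    using that bd by (intro integrable_const_bound[where B = b]) auto
  have int_Y2: "integrable M (\<lambda>\<omega>. (Y i \<omega>)\<^sup>2)" if "i \<in> I" for i
    using that power_mono[OF bd abs_ge_zero, of i _ 2]
    by (intro integrable_const_bound[where B = "b\<^sup>2"]) (auto intro!: AE_I2)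
  have int_exp: "integrable M (\<lambda>\<omega>. exp (t * Y i \<omega>))" if "i \<in> I" for i
    using that bd t
    by (intro integrable_const_bound[where B = "exp (t * b)"]) (auto intro!: AE_I2 simp: abs_le_iff)
  define K where "K = t\<^sup>2 * exp (t * b) / 2"
  have mgf1: "expectation (\<lambda>\<omega>. exp (t * Y i \<omega>))
      \<le> exp (t * expectation (Y i) + K * expectation (\<lambda>\<omega>. (Y i \<omega>)\<^sup>2))" if i: "i \<in> I" for i
  proof -
    have "expectation (\<lambda>\<omega>. exp (t * Y i \<omega>)) \<le> expectation (\<lambda>\<omega>. 1 + t * Y i \<omega> + K * (Y i \<omega>)\<^sup>2)"
    proof (rule integral_mono)
      show "integrable M (\<lambda>\<omega>. 1 + t * Y i \<omega> + K * (Y i \<omega>)\<^sup>2)"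
        using int_Y[OF i] int_Y2[OF i] by auto
      fix \<omega> assume "\<omega> \<in> space M"
      then have "\<bar>t * Y i \<omega>\<bar> \<le> t * b" using bd[OF i] t by (simp add: abs_mult)
      from exp_le_quadratic[OF this]
      show "exp (t * Y i \<omega>) \<le> 1 + t * Y i \<omega> + K * (Y i \<omega>)\<^sup>2"
        by (simp add: K_def power_mult_distrib algebra_simps)
    qed (rule int_exp[OF i])
    also have "\<dots> = 1 + (t * expectation (Y i) + K * expectation (\<lambda>\<omega>. (Y i \<omega>)\<^sup>2))"
      using int_Y[OF i] int_Y2[OF i] by (simp add: prob_space)
    also have "\<dots> \<le> exp (t * expectation (Y i) + K * expectation (\<lambda>\<omega>. (Y i \<omega>)\<^sup>2))"
      by (rule exp_ge_add_one_self)
    finally show ?thesis .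
  qed
  have NE: "neg_orthant_dep (\<lambda>i \<omega>. exp (t * Y i \<omega>)) I"
    using t by (intro neg_orthant_dep_mono[OF Y]) (auto intro!: monoI)
  have bd_sum: "(\<Sum>i\<in>I. Y i \<omega>) \<le> real (card I) * b" if "\<omega> \<in> space M" for \<omega>
    using sum_bounded_above[of I "\<lambda>i. Y i \<omega>" b] bd[OF _ that] by (auto simp: abs_le_iff)
  have int_S: "integrable M (\<lambda>\<omega>. exp (t * (\<Sum>i\<in>I. Y i \<omega>)))"
    using bd_sum t
    by (intro integrable_const_bound[where B = "exp (t * (real (card I) * b))"]) (auto intro!: AE_I2)
  have "ennreal (expectation (\<lambda>\<omega>. exp (t * (\<Sum>i\<in>I. Y i \<omega>)))) =
      (\<integral>\<^sup>+\<omega>. ennreal (exp (t * (\<Sum>i\<in>I. Y i \<omega>))) \<partial>M)"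
    by (rule nn_integral_eq_integral[symmetric]) (use int_S in auto)
  also have "\<dots> = (\<integral>\<^sup>+\<omega>. (\<Prod>i\<in>I. ennreal (exp (t * Y i \<omega>))) \<partial>M)"
    by (intro nn_integral_cong) (simp add: prod_ennreal exp_sum sum_distrib_left)
  also have "\<dots> \<le> (\<Prod>i\<in>I. \<integral>\<^sup>+\<omega>. ennreal (exp (t * Y i \<omega>)) \<partial>M)"
    by (rule neg_orthant_dep_nn_integral_prod_le[OF NE]) simp
  also have "\<dots> = (\<Prod>i\<in>I. ennreal (expectation (\<lambda>\<omega>. exp (t * Y i \<omega>))))"
    by (intro prod.cong refl nn_integral_eq_integral int_exp) auto
  also have "\<dots> = ennreal (\<Prod>i\<in>I. expectation (\<lambda>\<omega>. exp (t * Y i \<omega>)))"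
    by (rule prod_ennreal) simp
  finally have "expectation (\<lambda>\<omega>. exp (t * (\<Sum>i\<in>I. Y i \<omega>))) \<le> (\<Prod>i\<in>I. expectation (\<lambda>\<omega>. exp (t * Y i \<omega>)))"
    by (subst (asm) ennreal_le_iff) (auto intro!: prod_nonneg)
  also have "\<dots> \<le> (\<Prod>i\<in>I. exp (t * expectation (Y i) + K * expectation (\<lambda>\<omega>. (Y i \<omega>)\<^sup>2)))"
    by (intro prod_mono conjI mgf1) auto
  also have "\<dots> = exp (t * (\<Sum>i\<in>I. expectation (Y i)) + K * (\<Sum>i\<in>I. expectation (\<lambda>\<omega>. (Y i \<omega>)\<^sup>2)))"
    by (simp add: exp_sum[symmetric] sum.distrib sum_distrib_left)
  also have "\<dots> \<le> exp (t * (\<Sum>i\<in>I. expectation (Y i)) + K * B)"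
    using B t by (auto simp: K_def intro!: mult_left_mono)
  finally have mgf: "expectation (\<lambda>\<omega>. exp (t * (\<Sum>i\<in>I. Y i \<omega>)))
      \<le> exp (t * (\<Sum>i\<in>I. expectation (Y i)) + K * B)" .
  have "\<P>(\<omega> in M. (\<Sum>i\<in>I. Y i \<omega> - expectation (Y i)) \<ge> r) =
      \<P>(\<omega> in M. (\<Sum>i\<in>I. Y i \<omega>) \<ge> (\<Sum>i\<in>I. expectation (Y i)) + r)"
    by (simp add: sum_subtractf le_diff_eq add.commute)
  also have "\<dots> \<le> exp (- t * ((\<Sum>i\<in>I. expectation (Y i)) + r)) *
      (\<integral>\<omega>\<in>space M. exp (t * (\<Sum>i\<in>I. Y i \<omega>)) \<partial>M)"
    using int_S t by (intro Chernoff_ineq_ge) (auto simp: set_integrable_def cong: Bochner_Integration.integrable_cong)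
  also have "\<dots> \<le> exp (- t * ((\<Sum>i\<in>I. expectation (Y i)) + r)) *
      exp (t * (\<Sum>i\<in>I. expectation (Y i)) + K * B)"
    using mgf by (intro mult_left_mono) (simp_all add: set_integral_space[OF int_S])
  also have "\<dots> = exp (t\<^sup>2 * exp (t * b) * B / 2 - t * r)"
    by (simp add: exp_add[symmetric] K_def algebra_simps)
  finally show ?thesis .
qed

lemma neg_orthant_dep_tail_bound:
  assumes Y: "neg_orthant_dep Y I"
    and bd: "\<And>i \<omega>. i \<in> I \<Longrightarrow> \<omega> \<in> space M \<Longrightarrow> \<bar>Y i \<omega>\<bar> \<le> b"
    and B: "(\<Sum>i\<in>I. expectation (\<lambda>\<omega>. (Y i \<omega>)\<^sup>2)) \<le> B"
    and t: "t > 0"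
  shows "\<P>(\<omega> in M. \<bar>\<Sum>i\<in>I. Y i \<omega> - expectation (Y i)\<bar> \<ge> r) \<le> 2 * exp (t\<^sup>2 * exp (t * b) * B / 2 - t * r)"
proof -
  note fin [simp] = neg_orthant_depD(1)[OF Y] and rv [measurable] = neg_orthant_depD(2)[OF Y]
  let ?S = "\<lambda>\<omega>. \<Sum>i\<in>I. Y i \<omega> - expectation (Y i)"
  have minus: "neg_orthant_dep (\<lambda>i \<omega>. - Y i \<omega>) I"
    by (intro neg_orthant_dep_antimono[OF Y]) (auto intro!: antimonoI)
  have "\<P>(\<omega> in M. \<bar>?S \<omega>\<bar> \<ge> r) \<le> prob ({\<omega> \<in> space M. ?S \<omega> \<ge> r} \<union> {\<omega> \<in> space M. (\<Sum>i\<in>I. - Y i \<omega> - expectation (\<lambda>\<omega>. - Y i \<omega>)) \<ge> r})"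
    by (intro finite_measure_mono) (auto simp: sum_subtractf sum_negf abs_real_def split: if_splits)
  also have "\<dots> \<le> \<P>(\<omega> in M. ?S \<omega> \<ge> r) + \<P>(\<omega> in M. (\<Sum>i\<in>I. - Y i \<omega> - expectation (\<lambda>\<omega>. - Y i \<omega>)) \<ge> r)"
    by (intro measure_Un_le) measurable
  also have "\<dots> \<le> 2 * exp (t\<^sup>2 * exp (t * b) * B / 2 - t * r)"
    using neg_orthant_dep_upper_tail_bound[OF Y bd B t, of r]
      neg_orthant_dep_upper_tail_bound[OF minus _ _ t, of b B r] bd B by simp
  finally show ?thesis .
qed

end

section \<open>Elementary inequalities for truncation\<close>

text \<open>A discrete integral test: the summand is dominated by the decrement of
  \<open>k powr (1 - q) / (q - 1)\<close>, and these decrements telescope.\<close>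

lemma sum_powr_tail_le:
  fixes q :: real
  assumes q: "q > 1" and m: "m \<ge> (1::nat)"
  shows "(\<Sum>n=Suc m..N. real n powr (- q)) \<le> real m powr (1 - q) / (q - 1)"
proof -
  have decrement: "(q - 1) * real (Suc k) powr (- q) \<le> real k powr (1 - q) - real (Suc k) powr (1 - q)"
    if k: "k \<ge> 1" for k
  proof -
    define u where "u = ln (real (Suc k)) - ln (real k)"
    have "ln (real k / real (Suc k)) \<le> real k / real (Suc k) - 1"
      using k by (intro ln_le_minus_one) simp
    then have u: "1 / real (Suc k) \<le> u"
      using k by (simp add: u_def ln_div field_simps)
    have "1 + (q - 1) / real (Suc k) \<le> 1 + (q - 1) * u"
      using mult_left_mono[OF u, of "q - 1"] q by simp
    also have "\<dots> \<le> exp ((q - 1) * u)" by (rule exp_ge_add_one_self)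
    finally have "real (Suc k) powr (1 - q) * (1 + (q - 1) / real (Suc k))
        \<le> real (Suc k) powr (1 - q) * exp ((q - 1) * u)"
      by (rule mult_left_mono) simp
    also have "\<dots> = real k powr (1 - q)"
      using k by (simp add: powr_def u_def exp_add[symmetric] algebra_simps)
    finally have *: "real (Suc k) powr (1 - q) + (q - 1) * (real (Suc k) powr (1 - q) / real (Suc k)) \<le> real k powr (1 - q)"
      unfolding distrib_left by (simp add: mult.commute)
    have "real (Suc k) powr (1 - q) / real (Suc k) = real (Suc k) powr (- q)"
      using powr_diff[of "real (Suc k)" "1 - q" 1] by simp
    with * show ?thesis by (simp only: le_diff_eq add.commute)
  qed
  have telescope: "(q - 1) * (\<Sum>n=Suc m..N. real n powr (- q)) \<le> real m powr (1 - q) - real N powr (1 - q)"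
    if "m \<le> N" for N
    using that
  proof (induction N rule: dec_induct)
    case (step n)
    then have eq: "(\<Sum>k=Suc m..Suc n. real k powr (- q)) = (\<Sum>k=Suc m..n. real k powr (- q)) + real (Suc n) powr (- q)"
      by simp
    have "1 \<le> n" using step.hyps m by simp
    from decrement[OF this] step.IH show ?case unfolding eq distrib_left by linarith
  qed simp
  show ?thesis
  proof (cases "m \<le> N")
    case True
    have "(q - 1) * (\<Sum>n=Suc m..N. real n powr (- q)) \<le> real m powr (1 - q)"
      using telescope[OF True] powr_ge_zero[of "real N" "1 - q"] by linarith
    then show ?thesis using q by (simp add: pos_le_divide_eq mult.commute)
  qed (use q in auto)
qed

text \<open>Up to \<open>n \<approx> y\<close> the terms are at most \<open>1\<close>; beyond, they decay like \<open>n powr (- q)\<close> and their sum is again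
  of order \<open>y\<close>. That the bound is linear in \<open>y\<close> is the point: after inserting a random \<open>y\<close>, a finite
  mean of \<open>y\<close> suffices to sum the expectations.\<close>

lemma sum_min_powr_le:
  fixes y q :: real
  assumes q: "q > 1" and y: "y \<ge> 0"
  shows "(\<Sum>n=1..N. min (y / real n) 1 powr q) \<le> (1 + y) * (q / (q - 1))"
proof -
  \<comment> \<open>Rounding \<open>y\<close> up to a positive integer makes the tail estimate applicable for \<open>y < 1\<close> as well.\<close>
  define m where "m = nat \<lfloor>y\<rfloor> + 1"
  have m: "m \<ge> 1" "y \<le> real m" "real m \<le> 1 + y"
    using y unfolding m_def by linarith+
  have "(\<Sum>n=1..N. min (y / real n) 1 powr q)
      \<le> (\<Sum>n=1..N. (if n \<le> m then 1 else real m powr q * real n powr (- q)))"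
  proof (rule sum_mono)
    fix n assume n: "n \<in> {1..N}"
    show "min (y / real n) 1 powr q \<le> (if n \<le> m then 1 else real m powr q * real n powr (- q))"
    proof (cases "n \<le> m")
      case True
      have "min (y / real n) 1 powr q \<le> 1 powr q"
        using y q by (intro powr_mono2) auto
      then show ?thesis using True by simp
    next
      case False
      have "min (y / real n) 1 powr q \<le> (real m / real n) powr q"
        using y q n m by (intro powr_mono2) (auto simp: min_le_iff_disj divide_right_mono)
      also have "\<dots> = real m powr q * real n powr (- q)"
        using n m by (simp add: powr_divide powr_minus_divide)
      finally show ?thesis using False by simp
    qed
  qed
  also have "\<dots> = (\<Sum>n\<in>{1..N} \<inter> {n. n \<le> m}. 1) + (\<Sum>n\<in>{1..N} \<inter> - {n. n \<le> m}. real m powr q * real n powr (- q))"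
    by (rule sum.If_cases) simp
  also have "\<dots> \<le> (\<Sum>n=1..m. 1) + (\<Sum>n=Suc m..N. real m powr q * real n powr (- q))"
    by (intro add_mono sum_mono2) auto
  also have "\<dots> = real m + real m powr q * (\<Sum>n=Suc m..N. real n powr (- q))"
    by (simp add: sum_distrib_left)
  also have "\<dots> \<le> real m + real m powr q * (real m powr (1 - q) / (q - 1))"
    by (intro add_left_mono mult_left_mono sum_powr_tail_le q m) simp
  also have "\<dots> = real m * (q / (q - 1))"
    using m q by (simp add: powr_add[symmetric] field_simps)
  also have "\<dots> \<le> (1 + y) * (q / (q - 1))"
    using m q by (intro mult_right_mono) auto
  finally show ?thesis .
qed

text \<open>This quantifies how little mean a truncation at level \<open>b\<close> removes when a moment of order \<open>a\<close> is
  available.\<close>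

lemma diff_min_le_powr:
  fixes z b a :: real
  assumes "z \<ge> 0" "b > 0" "a \<ge> 1"
  shows "z - min z b \<le> z powr a / b powr (a - 1)"
proof (cases "z \<le> b")
  case False
  then have z: "z > 0" using assms by simp
  have "1 \<le> (z / b) powr (a - 1)"
    using False assms by (intro ge_one_powr_ge_zero) (auto simp: field_simps)
  then have "z * 1 \<le> z * (z / b) powr (a - 1)" using z by (intro mult_left_mono) auto
  also have "\<dots> = z powr a / b powr (a - 1)"
    using z assms powr_add[of z 1 "a - 1"] by (simp add: powr_divide)
  finally show ?thesis using False assms by simp
qed (use assms in simp)

lemma powr_le_one_plus_powr:
  fixes z :: real
  assumes "z \<ge> 0" "0 \<le> a" "a \<le> b"
  shows "z powr a \<le> 1 + z powr b"
proof (cases "z \<le> 1")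
  case True
  then show ?thesis using powr_mono2[of a z 1] assms powr_ge_zero[of z b] by (simp add: add_increasing2)
next
  case False
  then have "z powr a \<le> z powr b" using assms by (intro powr_mono) auto
  then show ?thesis by simp
qed

section \<open>The strong law for nonnegative weights and factors\<close>

text \<open>Independence between weights and factors is stated row by row because every estimate concerns a
  single row; the rows are brought together by the Borel--Cantelli lemma alone.\<close>

locale nonneg_weighted_array = prob_space M for M :: "'w measure" +
  fixes V :: "nat \<Rightarrow> nat \<Rightarrow> 'w \<Rightarrow> real" and x :: "nat \<Rightarrow> 'w \<Rightarrow> real" and p \<alpha> \<beta> A :: real
  assumes V_nonneg: "0 \<le> V n j \<omega>"
    and x_nonneg: "0 \<le> x j \<omega>"
    and V_nod: "n \<ge> 1 \<Longrightarrow> neg_orthant_dep (V n) {1..n}"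
    and x_indep: "indep_vars (\<lambda>_. borel) x {1..}"
    and x_ident: "j \<ge> 1 \<Longrightarrow> distr M borel (x j) = distr M borel (x 1)"
    and x_V_indep: "n \<ge> 1 \<Longrightarrow> indep_var (Pi\<^sub>M {1..n} (\<lambda>_. borel)) (\<lambda>\<omega>. \<lambda>j\<in>{1..n}. x j \<omega>)
      (Pi\<^sub>M {1..n} (\<lambda>_. borel)) (\<lambda>\<omega>. \<lambda>j\<in>{1..n}. V n j \<omega>)"
    and p_ge: "1 \<le> p" and p_less: "p < 2" and \<alpha>_gt: "\<alpha> > 2 * p" and \<beta>_gt: "\<beta> > 1"
    and exponents: "1 / \<alpha> + 1 / \<beta> = 1 / p"
    and x_moment: "integrable M (\<lambda>\<omega>. x 1 \<omega> powr \<beta>)"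
    and A_nonneg: "A \<ge> 0"
    and V_moment: "\<forall>\<^sub>F n in sequentially. (\<forall>j\<in>{1..n}. integrable M (\<lambda>\<omega>. V n j \<omega> powr \<alpha>)) \<and>
      (\<Sum>j=1..n. expectation (\<lambda>\<omega>. V n j \<omega> powr \<alpha>)) \<le> A * real n"
begin

lemma x_measurable: "j \<ge> 1 \<Longrightarrow> random_variable borel (x j)"
  using x_indep by (auto simp: indep_vars_def)

lemma V_measurable: "j \<in> {1..n} \<Longrightarrow> random_variable borel (V n j)"
  using neg_orthant_depD(2)[OF V_nod, of n j] by auto

lemma \<alpha>_ge: "\<alpha> > 2" and \<beta>_gt_p: "\<beta> > p" and \<beta>_less: "\<beta> < \<alpha>"
proof -
  show a: "\<alpha> > 2" using \<alpha>_gt p_ge by linarith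
  have "1 / \<beta> < 1 / p" using exponents a by (smt (verit) zero_less_divide_1_iff)
  then show "\<beta> > p" using p_ge \<beta>_gt by (simp add: field_simps)
  have "1 / \<alpha> < 1 / (2 * p)" using \<alpha>_gt p_ge by (intro divide_strict_left_mono) auto
  then have "1 / \<alpha> < 1 / \<beta>" using exponents by (simp add: field_simps)
  then show "\<beta> < \<alpha>" using a \<beta>_gt by (simp add: field_simps)
qed

lemma x_identically_distributed:
  assumes "j \<ge> 1" and [measurable]: "g \<in> borel_measurable borel"
  shows "integrable M (\<lambda>\<omega>. g (x j \<omega>) :: real) \<longleftrightarrow> integrable M (\<lambda>\<omega>. g (x 1 \<omega>))"
    and "expectation (\<lambda>\<omega>. g (x j \<omega>)) = expectation (\<lambda>\<omega>. g (x 1 \<omega>))"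
proof -
  note [measurable] = x_measurable[OF \<open>j \<ge> 1\<close>] x_measurable[of 1, simplified]
  show "integrable M (\<lambda>\<omega>. g (x j \<omega>)) \<longleftrightarrow> integrable M (\<lambda>\<omega>. g (x 1 \<omega>))"
    using integrable_distr_eq[of "x j" M borel g] integrable_distr_eq[of "x 1" M borel g] x_ident[OF \<open>j \<ge> 1\<close>]
    by simp
  show "expectation (\<lambda>\<omega>. g (x j \<omega>)) = expectation (\<lambda>\<omega>. g (x 1 \<omega>))"
    using integral_distr[of "x j" M borel g] integral_distr[of "x 1" M borel g] x_ident[OF \<open>j \<ge> 1\<close>]
    by simp
qed

lemma indep_x_V:
  assumes "j \<in> {1..n}"
  shows "indep_var borel (x j) borel (V n j)"
proof -
  have "indep_var borel ((\<lambda>f. f j) \<circ> (\<lambda>\<omega>. \<lambda>j\<in>{1..n}. x j \<omega>)) borel ((\<lambda>f. f j) \<circ> (\<lambda>\<omega>. \<lambda>j\<in>{1..n}. V n j \<omega>))"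
    by (rule indep_var_compose[OF x_V_indep]) (use assms in \<open>auto intro: measurable_component_singleton\<close>)
  then show ?thesis using assms by (simp add: comp_def)
qed

lemma integral_V_times_x:
  assumes j: "j \<in> {1..n}" and [measurable]: "f \<in> borel_measurable borel" "g \<in> borel_measurable borel"
    and f: "integrable M (\<lambda>\<omega>. f (V n j \<omega>) :: real)" and g: "integrable M (\<lambda>\<omega>. g (x 1 \<omega>) :: real)"
  shows "integrable M (\<lambda>\<omega>. f (V n j \<omega>) * g (x j \<omega>))"
    and "expectation (\<lambda>\<omega>. f (V n j \<omega>) * g (x j \<omega>)) = expectation (\<lambda>\<omega>. f (V n j \<omega>)) * expectation (\<lambda>\<omega>. g (x 1 \<omega>))"
proof -
  have "indep_var borel (g \<circ> x j) borel (f \<circ> V n j)"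
    by (rule indep_var_compose[OF indep_x_V[OF j]]) measurable
  then have ind: "indep_var borel (\<lambda>\<omega>. g (x j \<omega>)) borel (\<lambda>\<omega>. f (V n j \<omega>))" by (simp add: comp_def)
  have gj: "integrable M (\<lambda>\<omega>. g (x j \<omega>))" using x_identically_distributed(1)[of j g] g j by auto
  show "integrable M (\<lambda>\<omega>. f (V n j \<omega>) * g (x j \<omega>))"
    using indep_var_integrable[OF ind gj f] by (simp add: mult.commute)
  show "expectation (\<lambda>\<omega>. f (V n j \<omega>) * g (x j \<omega>)) = expectation (\<lambda>\<omega>. f (V n j \<omega>)) * expectation (\<lambda>\<omega>. g (x 1 \<omega>))"
    using indep_var_lebesgue_integral[OF ind gj f] x_identically_distributed(2)[of j g] j by (simp add: mult.commute)
qed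

definition x_level :: "nat \<Rightarrow> real" where "x_level n = real n powr (1 / \<beta>)"

definition truncated :: "nat \<Rightarrow> nat \<Rightarrow> 'w \<Rightarrow> real" where
  "truncated n j \<omega> = V n j \<omega> * min (x j \<omega>) (x_level n)"

text \<open>Up to the factor \<open>n powr (\<alpha> / \<beta>)\<close> this is the \<open>\<alpha>\<close>-th moment of \<open>min (x 1) (x_level n)\<close>.\<close>

definition level_moment :: "nat \<Rightarrow> real" where
  "level_moment n = expectation (\<lambda>\<omega>. min (x 1 \<omega> powr \<beta> / real n) 1 powr (\<alpha> / \<beta>))"

lemma x_level_nonneg: "x_level n \<ge> 0"
  by (simp add: x_level_def)

lemma x1_measurable [measurable]: "random_variable borel (x 1)" "random_variable borel (x (Suc 0))"
  using x_measurable[of 1] by simp_all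

lemma truncated_nonneg: "0 \<le> truncated n j \<omega>"
  by (auto simp: truncated_def V_nonneg x_nonneg x_level_nonneg)

lemma truncated_measurable: "j \<in> {1..n} \<Longrightarrow> random_variable borel (truncated n j)"
proof -
  assume j: "j \<in> {1..n}"
  note [measurable] = V_measurable[OF j]
  have [measurable]: "random_variable borel (x j)" using j by (intro x_measurable) simp
  show ?thesis unfolding truncated_def by measurable
qed

lemma min_one_powr_integrable:
  "integrable M (\<lambda>\<omega>. min (x 1 \<omega> powr \<beta> / real n) 1 powr (\<alpha> / \<beta>))"
proof (rule integrable_const_bound[where B = 1])
  have "min (x 1 \<omega> powr \<beta> / real n) 1 powr (\<alpha> / \<beta>) \<le> 1 powr (\<alpha> / \<beta>)" for \<omega>
    using \<alpha>_ge \<beta>_gt by (intro powr_mono2) auto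
  then show "AE \<omega> in M. norm (min (x 1 \<omega> powr \<beta> / real n) 1 powr (\<alpha> / \<beta>)) \<le> 1" by simp
qed measurable

lemma level_moment_nonneg: "level_moment n \<ge> 0"
  unfolding level_moment_def by (intro integral_nonneg_AE) simp

lemma summable_level_moment: "summable level_moment"
proof -
  define q where "q = \<alpha> / \<beta>"
  have q: "q > 1" using \<beta>_less \<beta>_gt by (simp add: q_def)
  have "(\<Sum>n<N. level_moment n) \<le> expectation (\<lambda>\<omega>. (1 + x 1 \<omega> powr \<beta>) * (q / (q - 1)))" for N
  proof -
    have "(\<Sum>n<N. level_moment n) = expectation (\<lambda>\<omega>. \<Sum>n<N. min (x 1 \<omega> powr \<beta> / real n) 1 powr q)"
      unfolding level_moment_def q_def
      by (rule Bochner_Integration.integral_sum[symmetric]) (rule min_one_powr_integrable)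
    also have "\<dots> \<le> expectation (\<lambda>\<omega>. (1 + x 1 \<omega> powr \<beta>) * (q / (q - 1)))"
    proof (rule integral_mono)
      fix \<omega>
      have "(\<Sum>n<N. min (x 1 \<omega> powr \<beta> / real n) 1 powr q) \<le> (\<Sum>n=1..N. min (x 1 \<omega> powr \<beta> / real n) 1 powr q)"
      proof -
        \<comment> \<open>The term for \<open>n = 0\<close> vanishes since division by zero yields \<open>0\<close>.\<close>
        have "(\<Sum>n<N. min (x 1 \<omega> powr \<beta> / real n) 1 powr q)
            \<le> (\<Sum>n\<in>insert 0 {1..N}. min (x 1 \<omega> powr \<beta> / real n) 1 powr q)"
          by (intro sum_mono2) auto
        then show ?thesis by simp
      qed
      also have "\<dots> \<le> (1 + x 1 \<omega> powr \<beta>) * (q / (q - 1))"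
        by (rule sum_min_powr_le[OF q]) simp
      finally show "(\<Sum>n<N. min (x 1 \<omega> powr \<beta> / real n) 1 powr q) \<le> (1 + x 1 \<omega> powr \<beta>) * (q / (q - 1))" .
    qed (use x_moment min_one_powr_integrable in \<open>auto simp: q_def\<close>)
    finally show ?thesis .
  qed
  then show ?thesis
    by (intro summableI_nonneg_bounded level_moment_nonneg)
qed


text \<open>The rows for which the moment condition on the weights is in force; all but finitely many are of
  this kind, and rows of the other kind may have infinite moments.\<close>

definition bounded_row :: "nat \<Rightarrow> bool" where
  "bounded_row n \<longleftrightarrow> n \<ge> 1 \<and> (\<forall>j\<in>{1..n}. integrable M (\<lambda>\<omega>. V n j \<omega> powr \<alpha>)) \<and>
      (\<Sum>j=1..n. expectation (\<lambda>\<omega>. V n j \<omega> powr \<alpha>)) \<le> A * real n"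

lemma eventually_bounded_row: "\<forall>\<^sub>F n in sequentially. bounded_row n"
  using V_moment eventually_ge_at_top[of 1] unfolding bounded_row_def by eventually_elim auto

text \<open>The truncated \<open>\<alpha>\<close>-th power in the form to which \<open>sum_min_powr_le\<close> applies, with
  \<open>y = z powr \<beta>\<close> and \<open>q = \<alpha> / \<beta>\<close>.\<close>

lemma min_level_powr:
  assumes n: "n \<ge> 1" and z: "z \<ge> 0"
  shows "min z (x_level n) powr \<alpha> = real n powr (\<alpha> / \<beta>) * min (z powr \<beta> / real n) 1 powr (\<alpha> / \<beta>)"
proof (cases "z \<le> x_level n")
  case True
  have "z powr \<beta> \<le> x_level n powr \<beta>" using True z \<beta>_gt by (intro powr_mono2) auto
  also have "\<dots> = real n" using \<beta>_gt n by (simp add: x_level_def powr_powr)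
  finally have le: "z powr \<beta> \<le> real n" .
  then have "min (z powr \<beta> / real n) 1 = z powr \<beta> / real n" using n by simp
  moreover have "(z powr \<beta> / real n) powr (\<alpha> / \<beta>) = z powr \<alpha> / real n powr (\<alpha> / \<beta>)"
    using n \<beta>_gt by (simp add: powr_divide powr_powr)
  ultimately show ?thesis using True n by simp
next
  case False
  have "x_level n powr \<beta> \<le> z powr \<beta>" using False x_level_nonneg \<beta>_gt by (intro powr_mono2) auto
  moreover have "x_level n powr \<beta> = real n" using \<beta>_gt n by (simp add: x_level_def powr_powr)
  ultimately have "min (z powr \<beta> / real n) 1 = 1" using n by (simp add: field_simps)
  moreover have "min z (x_level n) = x_level n" using False by simp
  ultimately show ?thesis by (simp add: x_level_def powr_powr)
qed

lemma V_powr_integrable: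
  assumes "bounded_row n" "j \<in> {1..n}" "0 \<le> a" "a \<le> \<alpha>"
  shows "integrable M (\<lambda>\<omega>. V n j \<omega> powr a)"
    and "expectation (\<lambda>\<omega>. V n j \<omega> powr a) \<le> 1 + expectation (\<lambda>\<omega>. V n j \<omega> powr \<alpha>)"
proof -
  note [measurable] = V_measurable[OF assms(2)]
  have int: "integrable M (\<lambda>\<omega>. 1 + V n j \<omega> powr \<alpha>)"
    using assms by (auto simp: bounded_row_def)
  have le: "V n j \<omega> powr a \<le> 1 + V n j \<omega> powr \<alpha>" for \<omega>
    using assms V_nonneg by (intro powr_le_one_plus_powr)
  show *: "integrable M (\<lambda>\<omega>. V n j \<omega> powr a)"
    using le by (intro Bochner_Integration.integrable_bound[OF int]) auto
  have "expectation (\<lambda>\<omega>. V n j \<omega> powr a) \<le> expectation (\<lambda>\<omega>. 1 + V n j \<omega> powr \<alpha>)"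
    by (intro integral_mono * int le)
  also have "\<dots> = 1 + expectation (\<lambda>\<omega>. V n j \<omega> powr \<alpha>)"
    using assms by (simp add: bounded_row_def prob_space)
  finally show "expectation (\<lambda>\<omega>. V n j \<omega> powr a) \<le> 1 + expectation (\<lambda>\<omega>. V n j \<omega> powr \<alpha>)" .
qed

lemma sum_V_powr_le:
  assumes "bounded_row n" "0 \<le> a" "a \<le> \<alpha>"
  shows "(\<Sum>j=1..n. expectation (\<lambda>\<omega>. V n j \<omega> powr a)) \<le> (1 + A) * real n"
proof -
  have "(\<Sum>j=1..n. expectation (\<lambda>\<omega>. V n j \<omega> powr a))
      \<le> (\<Sum>j=1..n. 1 + expectation (\<lambda>\<omega>. V n j \<omega> powr \<alpha>))"
    by (intro sum_mono V_powr_integrable assms)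
  also have "\<dots> \<le> (1 + A) * real n"
    using assms by (simp add: sum.distrib bounded_row_def algebra_simps)
  finally show ?thesis .
qed

text \<open>The exponents balance: the \<open>n\<close> weights contribute a factor \<open>n\<close>, the truncated factor contributes
  \<open>n powr (\<alpha> / \<beta>)\<close> times a summable quantity, and \<open>1 + \<alpha> / \<beta> = \<alpha> / p\<close>.\<close>

lemma truncated_moment:
  assumes n: "bounded_row n"
  shows "j \<in> {1..n} \<Longrightarrow> integrable M (\<lambda>\<omega>. truncated n j \<omega> powr \<alpha>)"
    and "(\<Sum>j=1..n. expectation (\<lambda>\<omega>. truncated n j \<omega> powr \<alpha>))
      \<le> A * level_moment n * real n powr (\<alpha> / p)"
proof -
  have n1: "n \<ge> 1" using n by (simp add: bounded_row_def)
  let ?g = "\<lambda>z. real n powr (\<alpha> / \<beta>) * min (z powr \<beta> / real n) 1 powr (\<alpha> / \<beta>)"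
  have eq: "truncated n j \<omega> powr \<alpha> = V n j \<omega> powr \<alpha> * ?g (x j \<omega>)" for j \<omega>
    unfolding truncated_def
    by (simp add: powr_mult V_nonneg x_nonneg x_level_nonneg min_level_powr[OF n1 x_nonneg])
  have g: "?g \<in> borel_measurable borel" by measurable
  have gint: "integrable M (\<lambda>\<omega>. ?g (x 1 \<omega>))"
    by (rule integrable_mult_right) (rule min_one_powr_integrable)
  have f: "(\<lambda>v :: real. v powr \<alpha>) \<in> borel_measurable borel" by measurable
  have V: "integrable M (\<lambda>\<omega>. V n j \<omega> powr \<alpha>)" if "j \<in> {1..n}" for j
    using n that by (auto simp: bounded_row_def)
  show "integrable M (\<lambda>\<omega>. truncated n j \<omega> powr \<alpha>)" if "j \<in> {1..n}"
    unfolding eq using integral_V_times_x(1)[OF that f g V[OF that] gint] .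
  have "(\<Sum>j=1..n. expectation (\<lambda>\<omega>. truncated n j \<omega> powr \<alpha>)) =
      (\<Sum>j=1..n. expectation (\<lambda>\<omega>. V n j \<omega> powr \<alpha>) * (real n powr (\<alpha> / \<beta>) * level_moment n))"
  proof (intro sum.cong refl)
    fix j assume j: "j \<in> {1..n}"
    have "expectation (\<lambda>\<omega>. ?g (x 1 \<omega>)) = real n powr (\<alpha> / \<beta>) * level_moment n"
      unfolding level_moment_def by (rule integral_mult_right_zero)
    then show "expectation (\<lambda>\<omega>. truncated n j \<omega> powr \<alpha>) =
        expectation (\<lambda>\<omega>. V n j \<omega> powr \<alpha>) * (real n powr (\<alpha> / \<beta>) * level_moment n)"
      unfolding eq using integral_V_times_x(2)[OF j f g V[OF j] gint] by simp
  qed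
  also have "\<dots> = (\<Sum>j=1..n. expectation (\<lambda>\<omega>. V n j \<omega> powr \<alpha>)) * (real n powr (\<alpha> / \<beta>) * level_moment n)"
    by (rule sum_distrib_right[symmetric])
  also have "\<dots> \<le> A * real n * (real n powr (\<alpha> / \<beta>) * level_moment n)"
    using n by (intro mult_right_mono) (auto simp: bounded_row_def level_moment_nonneg)
  also have "\<dots> = A * level_moment n * (real n powr 1 * real n powr (\<alpha> / \<beta>))"
    by simp
  also have "real n powr 1 * real n powr (\<alpha> / \<beta>) = real n powr (\<alpha> / p)"
  proof -
    have "1 + \<alpha> / \<beta> = \<alpha> / p"
      using exponents \<alpha>_ge \<beta>_gt p_ge by (simp add: field_simps)
    then show ?thesis by (simp only: powr_add[symmetric])
  qed
  finally show "(\<Sum>j=1..n. expectation (\<lambda>\<omega>. truncated n j \<omega> powr \<alpha>))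
      \<le> A * level_moment n * real n powr (\<alpha> / p)" .
qed

text \<open>By the Borel--Cantelli lemma only finitely many \<open>n\<close> satisfy \<open>x n > x_level n\<close>. The level grows to
  infinity, so eventually it also exceeds these finitely many exceptional values.\<close>

lemma AE_x_below_level:
  "AE \<omega> in M. \<forall>\<^sub>F n in sequentially. \<forall>j\<in>{1..n}. x j \<omega> \<le> x_level n"
proof -
  \<comment> \<open>The sequence starts at index \<open>1\<close>; the value \<open>x 0\<close> may not even be measurable.\<close>
  define E where "E = (\<lambda>n. if n = 0 then {} else {\<omega> \<in> space M. x n \<omega> > x_level n})"
  have E [measurable]: "E n \<in> events" for n
    using x_measurable[of n] unfolding E_def by auto
  have "prob (E n) \<le> level_moment n" for n
  proof (cases "n = 0")
    case False
    then have n: "n \<ge> 1" by simp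
    note [measurable] = x_measurable[OF n]
    have "prob (E n) = expectation (\<lambda>\<omega>. indicator {x_level n<..} (x n \<omega>))"
    proof -
      have "(\<lambda>\<omega>. indicator {x_level n<..} (x n \<omega>)) = (\<lambda>\<omega>. indicator {\<omega>. x n \<omega> > x_level n} \<omega> :: real)"
        by (auto simp: indicator_def)
      then show ?thesis using False by (simp add: E_def Int_def conj_commute)
    qed
    also have "\<dots> = expectation (\<lambda>\<omega>. indicator {x_level n<..} (x 1 \<omega>))"
      by (rule x_identically_distributed(2)[OF n]) measurable
    also have "\<dots> \<le> level_moment n"
      unfolding level_moment_def
    proof (rule integral_mono)
      show "integrable M (\<lambda>\<omega>. indicator {x_level n<..} (x 1 \<omega>) :: real)"
        by (rule integrable_const_bound[where B = 1]) (auto simp: indicator_def)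
      fix \<omega>
      show "indicator {x_level n<..} (x 1 \<omega>) \<le> min (x 1 \<omega> powr \<beta> / real n) 1 powr (\<alpha> / \<beta>)"
      proof (cases "x 1 \<omega> > x_level n")
        case True
        have "x_level n powr \<beta> \<le> x 1 \<omega> powr \<beta>" using True x_level_nonneg \<beta>_gt by (intro powr_mono2) auto
        moreover have "x_level n powr \<beta> = real n" using \<beta>_gt n by (simp add: x_level_def powr_powr)
        ultimately have "min (x 1 \<omega> powr \<beta> / real n) 1 = 1" using n by (simp add: field_simps)
        then show ?thesis by simp
      qed simp
    qed (rule min_one_powr_integrable)
    finally show ?thesis .
  qed (simp add: E_def level_moment_nonneg)
  then have "summable (\<lambda>n. prob (E n))"
    by (intro summable_comparison_test'[OF summable_level_moment, of 0]) auto
  then have "AE \<omega> in M. \<forall>\<^sub>F n in sequentially. \<omega> \<in> space M - E n"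
    by (intro borel_cantelli_AE1) (auto simp: emeasure_eq_measure)
  then show ?thesis
  proof (rule AE_mp, intro AE_I2 impI)
    fix \<omega> assume \<omega>: "\<omega> \<in> space M" and "\<forall>\<^sub>F n in sequentially. \<omega> \<in> space M - E n"
    then obtain N where N: "\<And>n. n \<ge> N \<Longrightarrow> \<omega> \<notin> E n" unfolding eventually_sequentially by blast
    have "filterlim x_level at_top sequentially"
      unfolding x_level_def using \<beta>_gt by real_asymp
    then have "\<forall>\<^sub>F n in sequentially. (\<Sum>j\<le>N. x j \<omega>) \<le> x_level n"
      unfolding filterlim_at_top by blast
    then show "\<forall>\<^sub>F n in sequentially. \<forall>j\<in>{1..n}. x j \<omega> \<le> x_level n"
    proof eventually_elim
      case (elim n)
      show ?case
      proof
        fix j assume j: "j \<in> {1..n}"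
        show "x j \<omega> \<le> x_level n"
        proof (cases "j \<le> N")
          case True
          have "x j \<omega> \<le> (\<Sum>j\<le>N. x j \<omega>)"
            using True x_nonneg by (intro member_le_sum) auto
          then show ?thesis using elim by linarith
        next
          case False
          then have "x j \<omega> \<le> x_level j" using N[of j] j \<omega> by (auto simp: E_def not_less)
          also have "\<dots> \<le> x_level n"
            unfolding x_level_def using j \<beta>_gt by (intro powr_mono2) auto
          finally show ?thesis .
        qed
      qed
    qed
  qed
qed

lemma AE_truncated_below_level:
  assumes \<eta>: "\<eta> > 0"
  shows "AE \<omega> in M. \<forall>\<^sub>F n in sequentially. \<forall>j\<in>{1..n}. truncated n j \<omega> \<le> \<eta> * real n powr (1 / p)"
proof -
  define E where "E = (\<lambda>n. \<Union>j\<in>{1..n}. {\<omega> \<in> space M. truncated n j \<omega> > \<eta> * real n powr (1 / p)})"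
  have E1: "{\<omega> \<in> space M. truncated n j \<omega> > c} \<in> events" if "j \<in> {1..n}" for n j c
    using truncated_measurable[OF that] by measurable
  have E [measurable]: "E n \<in> events" for n
    unfolding E_def by (intro sets.finite_UN E1) auto
  have bound: "prob (E n) \<le> A * \<eta> powr (- \<alpha>) * level_moment n" if row: "bounded_row n" for n
  proof -
    have n: "n \<ge> 1" using row by (simp add: bounded_row_def)
    define b where "b = \<eta> * real n powr (1 / p)"
    have b: "b > 0" using n \<eta> by (simp add: b_def)
    have "prob (E n) \<le> (\<Sum>j=1..n. prob {\<omega> \<in> space M. truncated n j \<omega> > b})"
      unfolding E_def b_def using E1 by (intro finite_measure_subadditive_finite) auto
    also have "\<dots> \<le> (\<Sum>j=1..n. expectation (\<lambda>\<omega>. truncated n j \<omega> powr \<alpha>) / b powr \<alpha>)"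
    proof (rule sum_mono)
      fix j assume j: "j \<in> {1..n}"
      note [measurable] = truncated_measurable[OF j]
      have "prob {\<omega> \<in> space M. truncated n j \<omega> > b} \<le> prob {\<omega> \<in> space M. truncated n j \<omega> powr \<alpha> \<ge> b powr \<alpha>}"
        using b \<alpha>_ge by (intro finite_measure_mono) (auto intro!: powr_mono2)
      also have "\<dots> \<le> expectation (\<lambda>\<omega>. truncated n j \<omega> powr \<alpha>) / b powr \<alpha>"
        using integral_Markov_inequality_measure[of M "\<lambda>\<omega>. truncated n j \<omega> powr \<alpha>" "{}" "b powr \<alpha>"]
          truncated_moment(1)[OF row j] b by auto
      finally show "prob {\<omega> \<in> space M. truncated n j \<omega> > b} \<le> expectation (\<lambda>\<omega>. truncated n j \<omega> powr \<alpha>) / b powr \<alpha>" .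
    qed
    also have "\<dots> = (\<Sum>j=1..n. expectation (\<lambda>\<omega>. truncated n j \<omega> powr \<alpha>)) / b powr \<alpha>"
      by (simp add: sum_divide_distrib)
    also have "\<dots> \<le> A * level_moment n * real n powr (\<alpha> / p) / b powr \<alpha>"
      by (intro divide_right_mono truncated_moment(2)[OF row]) simp
    also have "\<dots> = A * \<eta> powr (- \<alpha>) * level_moment n"
      using n \<eta> by (simp add: b_def powr_mult powr_powr powr_minus_divide)
    finally show ?thesis .
  qed
  have "summable (\<lambda>n. prob (E n))"
  proof (rule summable_comparison_test_ev)
    show "\<forall>\<^sub>F n in sequentially. norm (prob (E n)) \<le> A * \<eta> powr (- \<alpha>) * level_moment n"
      using eventually_bounded_row by eventually_elim (simp add: bound)
    show "summable (\<lambda>n. A * \<eta> powr (- \<alpha>) * level_moment n)"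
      by (intro summable_mult summable_level_moment)
  qed
  then have "AE \<omega> in M. \<forall>\<^sub>F n in sequentially. \<omega> \<in> space M - E n"
    by (intro borel_cantelli_AE1) (auto simp: emeasure_eq_measure)
  then show ?thesis
    by eventually_elim (auto simp: E_def not_less elim: eventually_mono)
qed


section \<open>Capped products and concentration\<close>

definition capped :: "real \<Rightarrow> nat \<Rightarrow> nat \<Rightarrow> 'w \<Rightarrow> real" where
  "capped \<eta> n j \<omega> = min (truncated n j \<omega>) (\<eta> * real n powr (1 / p))"

definition x_beta_moment :: real where
  "x_beta_moment = expectation (\<lambda>\<omega>. x 1 \<omega> powr \<beta>)"

text \<open>The larger of \<open>1\<close> and \<open>2 / \<beta>\<close>, written so that the exponent of the truncation level in the second
  moment bound is visible.\<close>

definition variance_exponent :: real where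
  "variance_exponent = 1 + (2 - min 2 \<beta>) / \<beta>"

text \<open>The power gap that makes the exponential bounds summable: \<open>1 < 2 / p\<close> because \<open>p < 2\<close>, and
  \<open>2 / \<beta> < 2 / p\<close> because \<open>p < \<beta>\<close>.\<close>

lemma variance_exponent_less: "variance_exponent < 2 / p"
proof (cases "\<beta> \<ge> 2")
  case True
  then show ?thesis using p_less p_ge by (simp add: variance_exponent_def field_simps)
next
  case False
  then have "variance_exponent = 2 / \<beta>" using \<beta>_gt by (simp add: variance_exponent_def field_simps)
  also have "\<dots> < 2 / p" using \<beta>_gt_p p_ge by (intro divide_strict_left_mono) auto
  finally show ?thesis .
qed

lemma x_beta_moment_nonneg: "x_beta_moment \<ge> 0"
  unfolding x_beta_moment_def by (intro integral_nonneg_AE) simp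

lemma capped_nonneg: "\<eta> \<ge> 0 \<Longrightarrow> 0 \<le> capped \<eta> n j \<omega>"
  by (simp add: capped_def truncated_nonneg)

lemma capped_measurable: "j \<in> {1..n} \<Longrightarrow> random_variable borel (capped \<eta> n j)"
  using truncated_measurable[of j n] unfolding capped_def by measurable

lemma capped_neg_orthant_dep:
  assumes n: "n \<ge> 1"
  shows "neg_orthant_dep (capped \<eta> n) {1..n}"
proof -
  \<comment> \<open>The inner \<open>max 0\<close> makes the map nondecreasing in \<open>w\<close> for every real \<open>z\<close>. Applied to the nonnegative \<open>x j\<close> it changes nothing.\<close>
  define \<phi> where "\<phi> = (\<lambda>z w :: real. min (w * max 0 (min z (x_level n))) (\<eta> * real n powr (1 / p)))"
  have "indep_vars (\<lambda>_. borel) x {1..n}" by (rule indep_vars_subset[OF x_indep]) auto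
  moreover have "mono (\<phi> z)" for z
    unfolding \<phi>_def by (intro monoI min.mono mult_right_mono) auto
  moreover have "(\<lambda>(z, w). \<phi> z w) \<in> borel_measurable (borel \<Otimes>\<^sub>M borel)"
    unfolding \<phi>_def by measurable
  ultimately have "neg_orthant_dep (\<lambda>j \<omega>. \<phi> (x j \<omega>) (V n j \<omega>)) {1..n}"
    by (rule neg_orthant_dep_indep_transform[OF V_nod[OF n] _ x_V_indep[OF n]])
  moreover have "(\<lambda>j \<omega>. \<phi> (x j \<omega>) (V n j \<omega>)) = capped \<eta> n"
    using x_nonneg x_level_nonneg by (simp add: fun_eq_iff \<phi>_def capped_def truncated_def)
  ultimately show ?thesis by simp
qed

text \<open>Of the two powers of the truncated factor, as much as \<open>x\<close> has moments for (at most \<open>2\<close>) is absorbed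
  by the \<open>\<beta>\<close>-th moment, and the rest is bounded by the truncation level.\<close>

lemma capped_second_moment:
  assumes row: "bounded_row n" and \<eta>: "\<eta> > 0"
  shows "(\<Sum>j=1..n. expectation (\<lambda>\<omega>. (capped \<eta> n j \<omega>)\<^sup>2))
    \<le> (1 + A) * (1 + x_beta_moment) * real n powr variance_exponent"
proof -
  \<comment> \<open>The order of the moment of \<open>x\<close> that is spent.\<close>
  define \<gamma> where "\<gamma> = min 2 \<beta>"
  define L where "L = x_level n powr (2 - \<gamma>)"
  have n: "n \<ge> 1" using row by (simp add: bounded_row_def)
  have xL: "x_level n > 0" using n by (simp add: x_level_def)
  have \<gamma>: "0 < \<gamma>" "\<gamma> \<le> 2" "\<gamma> \<le> \<beta>" using \<beta>_gt by (auto simp: \<gamma>_def)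
  have g: "(\<lambda>z :: real. 1 + z powr \<beta>) \<in> borel_measurable borel" by measurable
  have gint: "integrable M (\<lambda>\<omega>. 1 + x 1 \<omega> powr \<beta>)" using x_moment by auto
  have f: "(\<lambda>v :: real. v powr 2) \<in> borel_measurable borel" by measurable
  have le: "expectation (\<lambda>\<omega>. (capped \<eta> n j \<omega>)\<^sup>2) \<le> expectation (\<lambda>\<omega>. V n j \<omega> powr 2) * ((1 + x_beta_moment) * L)"
    if j: "j \<in> {1..n}" for j
  proof -
    note [measurable] = capped_measurable[OF j]
    have Vint: "integrable M (\<lambda>\<omega>. V n j \<omega> powr 2)"
      by (rule V_powr_integrable(1)[OF row j]) (use \<alpha>_ge in linarith)+
    note prod = integral_V_times_x[where f = "\<lambda>v. v powr 2" and g = "\<lambda>z. 1 + z powr \<beta>", OF j f g Vint gint]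
    have "expectation (\<lambda>\<omega>. (capped \<eta> n j \<omega>)\<^sup>2) \<le> expectation (\<lambda>\<omega>. (V n j \<omega> powr 2 * (1 + x j \<omega> powr \<beta>)) * L)"
    proof (rule integral_mono)
      show "integrable M (\<lambda>\<omega>. (capped \<eta> n j \<omega>)\<^sup>2)"
      proof (rule integrable_const_bound[where B = "(\<eta> * real n powr (1 / p))\<^sup>2"])
        have "(capped \<eta> n j \<omega>)\<^sup>2 \<le> (\<eta> * real n powr (1 / p))\<^sup>2" for \<omega>
          using \<eta> capped_nonneg[of \<eta> n j \<omega>] by (intro power_mono) (auto simp: capped_def)
        then show "AE \<omega> in M. norm ((capped \<eta> n j \<omega>)\<^sup>2) \<le> (\<eta> * real n powr (1 / p))\<^sup>2"
          by simp
      qed measurable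
      show "integrable M (\<lambda>\<omega>. (V n j \<omega> powr 2 * (1 + x j \<omega> powr \<beta>)) * L)"
        by (intro integrable_mult_left prod(1))
      fix \<omega>
      have "(capped \<eta> n j \<omega>)\<^sup>2 \<le> (truncated n j \<omega>)\<^sup>2"
        using \<eta> capped_nonneg[of \<eta> n j \<omega>] by (intro power_mono) (auto simp: capped_def)
      also have "\<dots> = V n j \<omega> powr 2 * (min (x j \<omega>) (x_level n))\<^sup>2"
        using V_nonneg by (simp add: truncated_def power_mult_distrib)
      also have "\<dots> \<le> V n j \<omega> powr 2 * ((1 + x j \<omega> powr \<beta>) * L)"
      proof (rule mult_left_mono)
        define z where "z = min (x j \<omega>) (x_level n)"
        have z: "0 \<le> z" "z \<le> x j \<omega>" "z \<le> x_level n"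
          using x_nonneg x_level_nonneg by (auto simp: z_def)
        have "z\<^sup>2 = z powr \<gamma> * z powr (2 - \<gamma>)"
          using z by (cases "z = 0") (simp_all add: powr_add[symmetric])
        also have "\<dots> \<le> (1 + x j \<omega> powr \<beta>) * L"
        proof (rule mult_mono)
          have "z powr \<gamma> \<le> x j \<omega> powr \<gamma>" using z \<gamma> by (intro powr_mono2) auto
          also have "\<dots> \<le> 1 + x j \<omega> powr \<beta>" using \<gamma> x_nonneg by (intro powr_le_one_plus_powr) auto
          finally show "z powr \<gamma> \<le> 1 + x j \<omega> powr \<beta>" .
          show "z powr (2 - \<gamma>) \<le> L" unfolding L_def using z \<gamma> by (intro powr_mono2) auto
        qed auto
        finally show "(min (x j \<omega>) (x_level n))\<^sup>2 \<le> (1 + x j \<omega> powr \<beta>) * L" by (simp add: z_def)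
      qed simp
      finally show "(capped \<eta> n j \<omega>)\<^sup>2 \<le> (V n j \<omega> powr 2 * (1 + x j \<omega> powr \<beta>)) * L" by simp
    qed
    also have "\<dots> = expectation (\<lambda>\<omega>. V n j \<omega> powr 2) * expectation (\<lambda>\<omega>. 1 + x 1 \<omega> powr \<beta>) * L"
      using prod(2) by simp
    also have "expectation (\<lambda>\<omega>. 1 + x 1 \<omega> powr \<beta>) = 1 + x_beta_moment"
      using x_moment by (simp add: x_beta_moment_def prob_space)
    finally show ?thesis by simp
  qed
  have "(\<Sum>j=1..n. expectation (\<lambda>\<omega>. (capped \<eta> n j \<omega>)\<^sup>2))
      \<le> (\<Sum>j=1..n. expectation (\<lambda>\<omega>. V n j \<omega> powr 2) * ((1 + x_beta_moment) * L))"
    by (intro sum_mono le)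
  also have "\<dots> = (\<Sum>j=1..n. expectation (\<lambda>\<omega>. V n j \<omega> powr 2)) * ((1 + x_beta_moment) * L)"
    by (simp add: sum_distrib_right)
  also have "\<dots> \<le> ((1 + A) * real n) * ((1 + x_beta_moment) * L)"
    using \<alpha>_ge x_beta_moment_nonneg
    by (intro mult_right_mono sum_V_powr_le[OF row]) (auto simp: L_def)
  also have "\<dots> = (1 + A) * (1 + x_beta_moment) * (real n powr 1 * L)" by simp
  also have "real n powr 1 * L = real n powr variance_exponent"
    by (simp only: L_def x_level_def powr_powr variance_exponent_def powr_add \<gamma>_def) simp
  finally show ?thesis .
qed

text \<open>Chosen so that capping at \<open>b = cap_ratio \<epsilon> * n powr (1 / p)\<close> and taking
  \<open>t = 2 / \<epsilon> * ln n / n powr (1 / p)\<close> makes \<open>exp (t * b)\<close> a power of \<open>n\<close> whose exponent is half of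
  the gap \<open>2 / p - variance_exponent\<close>.\<close>

definition cap_ratio :: "real \<Rightarrow> real" where
  "cap_ratio \<epsilon> = \<epsilon> * (2 / p - variance_exponent) / 4"

lemma cap_ratio_pos: "\<epsilon> > 0 \<Longrightarrow> cap_ratio \<epsilon> > 0"
  using variance_exponent_less by (simp add: cap_ratio_def)

text \<open>With \<open>t\<close> of order \<open>ln n / n powr (1 / p)\<close> the linear term of the Bernstein exponent is \<open>- 2 ln n\<close>, while
  the cap is chosen so small that the quadratic term still tends to \<open>0\<close>; the tail probabilities are
  then of order \<open>n powr (- 2)\<close>.\<close>

lemma capped_concentration:
  assumes \<epsilon>: "\<epsilon> > 0"
  defines "\<eta> \<equiv> cap_ratio \<epsilon>"
  shows "AE \<omega> in M. \<forall>\<^sub>F n in sequentially.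
    \<bar>\<Sum>j=1..n. capped \<eta> n j \<omega> - expectation (capped \<eta> n j)\<bar> < \<epsilon> * real n powr (1 / p)"
proof -
  define \<delta> where "\<delta> = 2 / p - variance_exponent"
  define D where "D = (1 + A) * (1 + x_beta_moment)"
  have \<delta>: "\<delta> > 0" using variance_exponent_less by (simp add: \<delta>_def)
  have \<eta>: "\<eta> > 0" using cap_ratio_pos[OF \<epsilon>] by (simp add: \<eta>_def)
  define E where "E = (\<lambda>n. {\<omega> \<in> space M.
    \<bar>\<Sum>j=1..n. capped \<eta> n j \<omega> - expectation (capped \<eta> n j)\<bar> \<ge> \<epsilon> * real n powr (1 / p)})"
  have E [measurable]: "E n \<in> events" for n
  proof -
    have [measurable]: "(\<lambda>\<omega>. \<Sum>j=1..n. capped \<eta> n j \<omega> - expectation (capped \<eta> n j)) \<in> borel_measurable M"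
      using capped_measurable[of _ n \<eta>] by (intro borel_measurable_sum borel_measurable_diff) auto
    show ?thesis unfolding E_def by measurable
  qed
  have bound: "prob (E n) \<le> 2 * exp ((2 / \<epsilon>)\<^sup>2 * D / 2 * (ln (real n) ^ 2 * real n powr (- \<delta> / 2)) - 2 * ln (real n))"
    if row: "bounded_row n" and n2: "n \<ge> 2" for n
  proof -
    define b where "b = \<eta> * real n powr (1 / p)"
    define t where "t = 2 / \<epsilon> * ln (real n) / real n powr (1 / p)"
    have t: "t > 0" using n2 \<epsilon> by (simp add: t_def)
    have tb: "exp (t * b) = real n powr (\<delta> / 2)"
      using n2 \<epsilon> by (simp add: t_def b_def \<eta>_def cap_ratio_def \<delta>_def powr_def field_simps)
    have "prob (E n) \<le> 2 * exp (t\<^sup>2 * exp (t * b) * (D * real n powr variance_exponent) / 2 - t * (\<epsilon> * real n powr (1 / p)))"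
      unfolding E_def
    proof (rule neg_orthant_dep_tail_bound[OF capped_neg_orthant_dep _ _ t])
      show "\<bar>capped \<eta> n j \<omega>\<bar> \<le> b" for j \<omega>
        using capped_nonneg[of \<eta> n j \<omega>] \<eta> by (simp add: capped_def b_def)
      show "(\<Sum>j=1..n. expectation (\<lambda>\<omega>. (capped \<eta> n j \<omega>)\<^sup>2)) \<le> D * real n powr variance_exponent"
        unfolding D_def by (rule capped_second_moment[OF row \<eta>])
    qed (use n2 in simp)
    also have "t * (\<epsilon> * real n powr (1 / p)) = 2 * ln (real n)"
      using \<epsilon> n2 by (simp add: t_def)
    also have "t\<^sup>2 * exp (t * b) * (D * real n powr variance_exponent) / 2 =
        (2 / \<epsilon>)\<^sup>2 * D / 2 * (ln (real n) ^ 2 * real n powr (- \<delta> / 2))"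
    proof -
      have "real n powr (\<delta> / 2) * real n powr variance_exponent / (real n powr (1 / p))\<^sup>2 =
          real n powr (\<delta> / 2 + variance_exponent - 2 / p)"
        using n2 by (simp add: powr_add powr_diff powr_power)
      also have "\<delta> / 2 + variance_exponent - 2 / p = - \<delta> / 2" by (simp add: \<delta>_def field_simps)
      finally have *: "real n powr (\<delta> / 2) * real n powr variance_exponent / (real n powr (1 / p))\<^sup>2 =
        real n powr (- \<delta> / 2)" .
      show ?thesis unfolding tb *[symmetric] by (simp add: t_def power_mult_distrib power_divide)
    qed
    finally show ?thesis .
  qed
  \<comment> \<open>Any power of \<open>n\<close> beats the logarithm, so half of the gap \<open>\<delta>\<close> is enough here.\<close>
  have lim: "(\<lambda>n. (2 / \<epsilon>)\<^sup>2 * D / 2 * (ln (real n) ^ 2 * real n powr (- \<delta> / 2))) \<longlonglongrightarrow> 0"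
    using \<delta> by real_asymp
  have "summable (\<lambda>n. prob (E n))"
  proof (rule summable_comparison_test_ev)
    show "\<forall>\<^sub>F n in sequentially. norm (prob (E n)) \<le> 2 * exp 1 * real n powr (- 2)"
      using eventually_bounded_row eventually_ge_at_top[of 2] order_tendstoD(2)[OF lim zero_less_one]
    proof eventually_elim
      case (elim n)
      have "prob (E n) \<le> 2 * exp (1 - 2 * ln (real n))"
        by (rule order_trans[OF bound[OF elim(1,2)]]) (use elim(3) in simp)
      also have "\<dots> = 2 * exp 1 * real n powr (- 2)"
        using elim(2) by (simp add: exp_diff powr_def exp_minus divide_inverse)
      finally show ?case by simp
    qed
    show "summable (\<lambda>n. 2 * exp 1 * real n powr (- 2))"
      by (intro summable_mult) (simp add: summable_real_powr_iff)
  qed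
  then have "AE \<omega> in M. \<forall>\<^sub>F n in sequentially. \<omega> \<in> space M - E n"
    by (intro borel_cantelli_AE1) (auto simp: emeasure_eq_measure)
  then show ?thesis
    by eventually_elim (auto simp: E_def not_le elim: eventually_mono)
qed

text \<open>The first summand accounts for cutting \<open>x\<close> and decays because \<open>\<beta> > p\<close>; the second accounts for
  capping the product.\<close>

lemma truncation_mean_error:
  assumes row: "bounded_row n" and \<eta>: "\<eta> > 0"
  shows "\<bar>\<Sum>j=1..n. expectation (\<lambda>\<omega>. V n j \<omega> * x j \<omega>) - expectation (capped \<eta> n j)\<bar> / real n powr (1 / p)
    \<le> (1 + A) * x_beta_moment * real n powr (1 / \<beta> - 1 / p) + \<eta> powr (1 - \<alpha>) * (A * level_moment n)"
proof -
  define a where "a = x_level n powr (\<beta> - 1)"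
  define b where "b = \<eta> * real n powr (1 / p)"
  have n: "n \<ge> 1" using row by (simp add: bounded_row_def)
  have pos: "x_level n > 0" "a > 0" "b > 0" using n \<eta> by (auto simp: x_level_def a_def b_def)
  have xint: "integrable M (\<lambda>\<omega>. x 1 \<omega>)"
  proof (rule Bochner_Integration.integrable_bound)
    show "integrable M (\<lambda>\<omega>. 1 + x 1 \<omega> powr \<beta>)" using x_moment by auto
    show "AE \<omega> in M. norm (x 1 \<omega>) \<le> norm (1 + x 1 \<omega> powr \<beta>)"
      using powr_le_one_plus_powr[of "x 1 _" 1 \<beta>] x_nonneg \<beta>_gt by (intro AE_I2) simp
  qed measurable
  have gap: "0 \<le> expectation (\<lambda>\<omega>. V n j \<omega> * x j \<omega>) - expectation (capped \<eta> n j) \<and>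
      expectation (\<lambda>\<omega>. V n j \<omega> * x j \<omega>) - expectation (capped \<eta> n j) \<le>
      expectation (\<lambda>\<omega>. V n j \<omega> powr 1) * x_beta_moment / a + expectation (\<lambda>\<omega>. truncated n j \<omega> powr \<alpha>) / b powr (\<alpha> - 1)"
    if j: "j \<in> {1..n}" for j
  proof -
    note [measurable] = capped_measurable[OF j]
    have V1: "integrable M (\<lambda>\<omega>. V n j \<omega> powr 1)"
      using \<alpha>_ge by (intro V_powr_integrable(1)[OF row j]) auto
    then have V: "integrable M (V n j)" using V_nonneg by simp
    have Vx: "integrable M (\<lambda>\<omega>. V n j \<omega> * x j \<omega>)"
      by (rule integral_V_times_x(1)[OF j, of "\<lambda>v. v" "\<lambda>z. z"]) (use V xint in auto)
    have Vxb: "integrable M (\<lambda>\<omega>. V n j \<omega> powr 1 * x j \<omega> powr \<beta>)"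
        "expectation (\<lambda>\<omega>. V n j \<omega> powr 1 * x j \<omega> powr \<beta>) = expectation (\<lambda>\<omega>. V n j \<omega> powr 1) * x_beta_moment"
      using integral_V_times_x[OF j, of "\<lambda>v. v powr 1" "\<lambda>z. z powr \<beta>"] V1 x_moment
      by (auto simp: x_beta_moment_def)
    have cint: "integrable M (capped \<eta> n j)"
      using \<eta> capped_nonneg[of \<eta> n j]
      by (intro integrable_const_bound[where B = b]) (auto intro!: AE_I2 simp: capped_def b_def)
    have Tint: "integrable M (\<lambda>\<omega>. truncated n j \<omega> powr \<alpha>)" by (rule truncated_moment(1)[OF row j])
    have bounds: "0 \<le> V n j \<omega> * x j \<omega> - capped \<eta> n j \<omega>"
        "V n j \<omega> * x j \<omega> - capped \<eta> n j \<omega> \<le> V n j \<omega> powr 1 * x j \<omega> powr \<beta> / a + truncated n j \<omega> powr \<alpha> / b powr (\<alpha> - 1)" for \<omega>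
    proof -
      have tr: "truncated n j \<omega> \<le> V n j \<omega> * x j \<omega>"
        unfolding truncated_def using V_nonneg by (intro mult_left_mono) auto
      then show "0 \<le> V n j \<omega> * x j \<omega> - capped \<eta> n j \<omega>" by (simp add: capped_def)
      have "V n j \<omega> * x j \<omega> - truncated n j \<omega> = V n j \<omega> powr 1 * (x j \<omega> - min (x j \<omega>) (x_level n))"
        using V_nonneg by (simp add: truncated_def algebra_simps)
      also have "\<dots> \<le> V n j \<omega> powr 1 * (x j \<omega> powr \<beta> / a)"
        unfolding a_def using x_nonneg pos \<beta>_gt by (intro mult_left_mono diff_min_le_powr) auto
      finally have 1: "V n j \<omega> * x j \<omega> - truncated n j \<omega> \<le> V n j \<omega> powr 1 * x j \<omega> powr \<beta> / a" by simp
      have 2: "truncated n j \<omega> - capped \<eta> n j \<omega> \<le> truncated n j \<omega> powr \<alpha> / b powr (\<alpha> - 1)"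
        unfolding capped_def b_def[symmetric] using truncated_nonneg pos \<alpha>_ge by (intro diff_min_le_powr) auto
      from 1 2 show "V n j \<omega> * x j \<omega> - capped \<eta> n j \<omega> \<le> V n j \<omega> powr 1 * x j \<omega> powr \<beta> / a + truncated n j \<omega> powr \<alpha> / b powr (\<alpha> - 1)"
        by linarith
    qed
    have eq: "expectation (\<lambda>\<omega>. V n j \<omega> * x j \<omega>) - expectation (capped \<eta> n j) =
        expectation (\<lambda>\<omega>. V n j \<omega> * x j \<omega> - capped \<eta> n j \<omega>)"
      by (rule Bochner_Integration.integral_diff[symmetric, OF Vx cint])
    have "expectation (\<lambda>\<omega>. V n j \<omega> * x j \<omega> - capped \<eta> n j \<omega>) \<le>
        expectation (\<lambda>\<omega>. V n j \<omega> powr 1 * x j \<omega> powr \<beta> / a + truncated n j \<omega> powr \<alpha> / b powr (\<alpha> - 1))"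
      by (intro integral_mono bounds Bochner_Integration.integrable_diff Bochner_Integration.integrable_add
          integrable_divide Vx cint Vxb Tint)
    also have "\<dots> = expectation (\<lambda>\<omega>. V n j \<omega> powr 1) * x_beta_moment / a + expectation (\<lambda>\<omega>. truncated n j \<omega> powr \<alpha>) / b powr (\<alpha> - 1)"
      using Vxb Tint by (subst Bochner_Integration.integral_add) auto
    finally show ?thesis unfolding eq using bounds(1) by (auto intro!: integral_nonneg_AE)
  qed
  let ?S = "\<Sum>j=1..n. expectation (\<lambda>\<omega>. V n j \<omega> * x j \<omega>) - expectation (capped \<eta> n j)"
  have "\<bar>?S\<bar> = ?S" using gap by (intro abs_of_nonneg sum_nonneg) blast
  also have "\<dots> \<le> (\<Sum>j=1..n. expectation (\<lambda>\<omega>. V n j \<omega> powr 1) * x_beta_moment / a + expectation (\<lambda>\<omega>. truncated n j \<omega> powr \<alpha>) / b powr (\<alpha> - 1))"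
    using gap by (intro sum_mono) blast
  also have "\<dots> = (\<Sum>j=1..n. expectation (\<lambda>\<omega>. V n j \<omega> powr 1)) * (x_beta_moment / a) + (\<Sum>j=1..n. expectation (\<lambda>\<omega>. truncated n j \<omega> powr \<alpha>)) / b powr (\<alpha> - 1)"
    by (simp add: sum.distrib sum_distrib_right sum_divide_distrib)
  also have "\<dots> \<le> (1 + A) * real n * (x_beta_moment / a) + A * level_moment n * real n powr (\<alpha> / p) / b powr (\<alpha> - 1)"
    using \<alpha>_ge pos x_beta_moment_nonneg
    by (intro add_mono mult_right_mono divide_right_mono truncated_moment(2)[OF row] sum_V_powr_le[OF row]) auto
  finally have "\<bar>?S\<bar> / real n powr (1 / p) \<le>
      ((1 + A) * real n * (x_beta_moment / a) + A * level_moment n * real n powr (\<alpha> / p) / b powr (\<alpha> - 1)) / real n powr (1 / p)"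
    by (rule divide_right_mono) simp
  also have "\<dots> = (1 + A) * x_beta_moment * (real n / a / real n powr (1 / p)) +
      A * level_moment n * (real n powr (\<alpha> / p) / b powr (\<alpha> - 1) / real n powr (1 / p))"
    by (simp add: add_divide_distrib)
  also have "real n / a / real n powr (1 / p) = real n powr (1 / \<beta> - 1 / p)"
  proof -
    have "real n powr 1 / a / real n powr (1 / p) = real n powr (1 - 1 / \<beta> * (\<beta> - 1) - 1 / p)"
      by (simp only: powr_diff[of "real n" "1 - 1 / \<beta> * (\<beta> - 1)" "1 / p"]
          powr_diff[of "real n" 1 "1 / \<beta> * (\<beta> - 1)"] a_def x_level_def powr_powr)
    also have "1 - 1 / \<beta> * (\<beta> - 1) - 1 / p = 1 / \<beta> - 1 / p" using \<beta>_gt by (simp add: field_simps)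
    finally show ?thesis using n by simp
  qed
  also have "real n powr (\<alpha> / p) / b powr (\<alpha> - 1) / real n powr (1 / p) = \<eta> powr (1 - \<alpha>)"
  proof -
    have "b powr (\<alpha> - 1) = \<eta> powr (\<alpha> - 1) * real n powr (\<alpha> / p - 1 / p)"
      using \<eta> by (simp add: b_def powr_mult powr_powr diff_divide_distrib)
    then have "real n powr (\<alpha> / p) / b powr (\<alpha> - 1) / real n powr (1 / p) = 1 / \<eta> powr (\<alpha> - 1)"
      using n by (simp add: powr_diff)
    then show ?thesis using powr_minus_divide[of \<eta> "\<alpha> - 1"] by simp
  qed
  finally show ?thesis by (simp add: mult.commute)
qed

text \<open>Almost surely both truncations are eventually invisible, so the centred row sum is the one of the
  capped variables up to a deterministic error in the means.\<close>

lemma weighted_strong_law: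
  "AE \<omega> in M. (\<lambda>n. 1 / real n powr (1 / p) *
    (\<Sum>j=1..n. V n j \<omega> * x j \<omega> - expectation (\<lambda>\<omega>. V n j \<omega> * x j \<omega>))) \<longlonglongrightarrow> 0"
proof -
  let ?T = "\<lambda>n \<omega>. 1 / real n powr (1 / p) *
    (\<Sum>j=1..n. V n j \<omega> * x j \<omega> - expectation (\<lambda>\<omega>. V n j \<omega> * x j \<omega>))"
  have eps: "AE \<omega> in M. \<forall>\<^sub>F n in sequentially. \<bar>?T n \<omega>\<bar> < 2 * \<epsilon>" if \<epsilon>: "\<epsilon> > 0" for \<epsilon>
  proof -
    define \<eta> where "\<eta> = cap_ratio \<epsilon>"
    have \<eta>: "\<eta> > 0" using cap_ratio_pos[OF \<epsilon>] by (simp add: \<eta>_def)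
    have "1 / \<beta> - 1 / p < 0" using \<beta>_gt_p p_ge by (simp add: frac_less2)
    then have "(\<lambda>n. (1 + A) * x_beta_moment * real n powr (1 / \<beta> - 1 / p)) \<longlonglongrightarrow> (1 + A) * x_beta_moment * 0"
      by (intro tendsto_mult tendsto_const tendsto_neg_powr filterlim_real_sequentially)
    moreover have "(\<lambda>n. \<eta> powr (1 - \<alpha>) * (A * level_moment n)) \<longlonglongrightarrow> \<eta> powr (1 - \<alpha>) * (A * 0)"
      by (intro tendsto_mult tendsto_const summable_LIMSEQ_zero summable_level_moment)
    ultimately have "(\<lambda>n. (1 + A) * x_beta_moment * real n powr (1 / \<beta> - 1 / p) + \<eta> powr (1 - \<alpha>) * (A * level_moment n))
        \<longlonglongrightarrow> (1 + A) * x_beta_moment * 0 + \<eta> powr (1 - \<alpha>) * (A * 0)"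
      by (rule tendsto_add)
    then have err: "\<forall>\<^sub>F n in sequentially.
        (1 + A) * x_beta_moment * real n powr (1 / \<beta> - 1 / p) + \<eta> powr (1 - \<alpha>) * (A * level_moment n) < \<epsilon>"
      by (rule order_tendstoD(2)) (use \<epsilon> in simp)
    show ?thesis
      using capped_concentration[OF \<epsilon>] AE_x_below_level AE_truncated_below_level[OF \<eta>]
    proof eventually_elim
      case (elim \<omega>)
      from elim(1)[folded \<eta>_def] elim(2,3) eventually_bounded_row err
      show "\<forall>\<^sub>F n in sequentially. \<bar>?T n \<omega>\<bar> < 2 * \<epsilon>"
      proof eventually_elim
        case (elim n)
        define N where "N = real n powr (1 / p)"
        have N: "N > 0" using elim(4) by (simp add: N_def bounded_row_def)
        have "V n j \<omega> * x j \<omega> = capped \<eta> n j \<omega>" if "j \<in> {1..n}" for j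
          using elim(2,3) that by (auto simp: capped_def truncated_def)
        then have "(\<Sum>j=1..n. V n j \<omega> * x j \<omega> - expectation (\<lambda>\<omega>. V n j \<omega> * x j \<omega>)) =
            (\<Sum>j=1..n. capped \<eta> n j \<omega> - expectation (capped \<eta> n j)) -
            (\<Sum>j=1..n. expectation (\<lambda>\<omega>. V n j \<omega> * x j \<omega>) - expectation (capped \<eta> n j))"
          by (simp add: sum_subtractf)
        then have "\<bar>?T n \<omega>\<bar> \<le> \<bar>\<Sum>j=1..n. capped \<eta> n j \<omega> - expectation (capped \<eta> n j)\<bar> / N +
            \<bar>\<Sum>j=1..n. expectation (\<lambda>\<omega>. V n j \<omega> * x j \<omega>) - expectation (capped \<eta> n j)\<bar> / N"
          using N by (simp add: abs_mult N_def[symmetric] add_divide_distrib[symmetric] divide_right_mono abs_triangle_ineq4)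
        also have "\<dots> < \<epsilon> + \<epsilon>"
        proof (rule add_strict_mono)
          show "\<bar>\<Sum>j=1..n. capped \<eta> n j \<omega> - expectation (capped \<eta> n j)\<bar> / N < \<epsilon>"
            using elim(1) N by (simp add: N_def divide_less_eq)
          show "\<bar>\<Sum>j=1..n. expectation (\<lambda>\<omega>. V n j \<omega> * x j \<omega>) - expectation (capped \<eta> n j)\<bar> / N < \<epsilon>"
            using truncation_mean_error[OF elim(4) \<eta>] elim(5) unfolding N_def by linarith
        qed
        finally show ?case by simp
      qed
    qed
  qed
  have "AE \<omega> in M. \<forall>k::nat. \<forall>\<^sub>F n in sequentially. \<bar>?T n \<omega>\<bar> < 2 * (1 / real (Suc k))"
    unfolding AE_all_countable by (intro allI eps) simp
  then show ?thesis
  proof eventually_elim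
    case (elim \<omega>)
    show ?case
    proof (rule tendstoI)
      fix e :: real assume "e > 0"
      then obtain k where k: "1 / real (Suc k) < e / 2" using nat_approx_posE[of "e / 2"] by auto
      show "\<forall>\<^sub>F n in sequentially. dist (?T n \<omega>) 0 < e"
        using elim[rule_format, of k] by eventually_elim (use k in \<open>simp add: dist_real_def\<close>)
    qed
  qed
qed

end

section \<open>Signed weights and functions of the sample\<close>

lemma (in prob_space) sigma_sets_compose_subset:
  assumes U: "random_variable R U" and h: "h \<in> R \<rightarrow>\<^sub>M R'"
  shows "sigma_sets (space M) {(\<lambda>\<omega>. h (U \<omega>)) -` A \<inter> space M | A. A \<in> sets R'}
    \<subseteq> sigma_sets (space M) {U -` A \<inter> space M | A. A \<in> sets R}"
proof (rule sigma_sets_mono, safe)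
  fix A assume A: "A \<in> sets R'"
  have "(\<lambda>\<omega>. h (U \<omega>)) -` A \<inter> space M = U -` (h -` A \<inter> space R) \<inter> space M"
    using measurable_space[OF U] by auto
  then show "(\<lambda>\<omega>. h (U \<omega>)) -` A \<inter> space M \<in> sigma_sets (space M) {U -` A \<inter> space M | A. A \<in> sets R}"
    using measurable_sets[OF h A] by (intro sigma_sets.Basic) blast
qed

text \<open>This passes independence of the whole weight array and the whole sample on to single rows and to
  functions of single entries.\<close>

lemma (in prob_space) indep_var_het_compose:
  assumes ind: "indep_var_het S Y T Z" and f: "f \<in> S \<rightarrow>\<^sub>M S'" and g: "g \<in> T \<rightarrow>\<^sub>M T'"
  shows "indep_var_het S' (\<lambda>\<omega>. f (Y \<omega>)) T' (\<lambda>\<omega>. g (Z \<omega>))"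
proof -
  have Y: "random_variable S Y" and Z: "random_variable T Z"
    using ind by (auto simp: indep_var_het_def)
  have rv: "random_variable S' (\<lambda>\<omega>. f (Y \<omega>))" "random_variable T' (\<lambda>\<omega>. g (Z \<omega>))"
    using measurable_compose[OF Y f] measurable_compose[OF Z g] by auto
  note sub = sigma_sets_compose_subset[OF Y f] sigma_sets_compose_subset[OF Z g]
  from ind have *: "indep_set (sigma_sets (space M) {Y -` A \<inter> space M | A. A \<in> sets S})
      (sigma_sets (space M) {Z -` A \<inter> space M | A. A \<in> sets T})"
    by (simp add: indep_var_het_def)
  show ?thesis
    unfolding indep_var_het_def indep_sets2_eq
    using rv subset_trans[OF sub(1) indep_setD_ev1[OF *]] subset_trans[OF sub(2) indep_setD_ev2[OF *]]
      indep_setD[OF *] subsetD[OF sub(1)] subsetD[OF sub(2)]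
    by (intro conjI ballI) simp_all
qed

lemma (in prob_space) indep_var_het_swap:
  assumes "indep_var_het S Y T Z"
  shows "indep_var_het T Z S Y"
proof -
  from assms have *: "indep_set (sigma_sets (space M) {Y -` A \<inter> space M | A. A \<in> sets S})
      (sigma_sets (space M) {Z -` A \<inter> space M | A. A \<in> sets T})"
    by (simp add: indep_var_het_def)
  have "prob (b \<inter> a) = prob b * prob a"
    if "a \<in> sigma_sets (space M) {Y -` A \<inter> space M | A. A \<in> sets S}"
      "b \<in> sigma_sets (space M) {Z -` A \<inter> space M | A. A \<in> sets T}" for a b
    using indep_setD[OF * that] by (subst Int_commute, subst mult.commute)
  then show ?thesis
    using assms indep_setD_ev1[OF *] indep_setD_ev2[OF *]
    unfolding indep_var_het_def indep_sets2_eq by (intro conjI ballI) simp_all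
qed

text \<open>The weights now may take both signs and the sample points lie in an arbitrary topological space;
  real factors arise by applying Borel functions to the sample.\<close>

locale nod_weighted_sample = prob_space M for M :: "'w measure" +
  fixes W :: "nat \<Rightarrow> nat \<Rightarrow> 'w \<Rightarrow> real" and X :: "nat \<Rightarrow> 'w \<Rightarrow> 'b::topological_space" and p \<alpha> \<beta> A B :: real
  assumes W_nod: "n \<ge> 1 \<Longrightarrow> neg_orthant_dep (W n) {1..n}"
    and X_indep: "indep_vars (\<lambda>_. borel) X {1..}"
    and X_ident: "j \<ge> 1 \<Longrightarrow> distr M borel (X j) = distr M borel (X 1)"
    and W_X_indep: "n \<ge> 1 \<Longrightarrow> indep_var_het (Pi\<^sub>M {1..n} (\<lambda>_. borel)) (\<lambda>\<omega>. \<lambda>j\<in>{1..n}. W n j \<omega>)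
      (Pi\<^sub>M {1..n} (\<lambda>_. borel)) (\<lambda>\<omega>. \<lambda>j\<in>{1..n}. X j \<omega>)"
    and p_ge: "1 \<le> p" and p_less: "p < 2" and \<alpha>_gt: "\<alpha> > 2 * p" and \<beta>_gt: "\<beta> > 1"
    and exponents: "1 / \<alpha> + 1 / \<beta> = 1 / p"
    and A_nonneg: "A \<ge> 0" and B_nonneg: "B \<ge> 0"
    and W_moment: "\<forall>\<^sub>F n in sequentially. (\<forall>j\<in>{1..n}. integrable M (\<lambda>\<omega>. \<bar>W n j \<omega>\<bar> powr \<alpha>)) \<and>
      (\<Sum>j=1..n. expectation (\<lambda>\<omega>. \<bar>W n j \<omega>\<bar> powr \<alpha>)) \<le> A * real n"
    and W_mean: "\<forall>\<^sub>F n in sequentially. (\<Sum>j=1..n. expectation (\<lambda>\<omega>. \<bar>W n j \<omega>\<bar>)) \<le> B * real n powr (1 / p)"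
begin

lemma X_measurable: "j \<ge> 1 \<Longrightarrow> random_variable borel (X j)"
  using X_indep by (auto simp: indep_vars_def)

lemma W_measurable: "j \<in> {1..n} \<Longrightarrow> random_variable borel (W n j)"
  using neg_orthant_depD(2)[OF W_nod, of n j] by auto

lemma integrable_X_powr_one:
  assumes [measurable]: "h \<in> borel_measurable borel" and h: "integrable M (\<lambda>\<omega>. \<bar>h (X 1 \<omega>)\<bar> powr \<beta>)"
  shows "integrable M (\<lambda>\<omega>. h (X 1 \<omega>) :: real)"
proof (rule Bochner_Integration.integrable_bound)
  note [measurable] = X_measurable[of 1, simplified]
  show "integrable M (\<lambda>\<omega>. 1 + \<bar>h (X 1 \<omega>)\<bar> powr \<beta>)" using h by auto
  show "random_variable borel (\<lambda>\<omega>. h (X 1 \<omega>))" by simp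
  show "AE \<omega> in M. norm (h (X 1 \<omega>)) \<le> norm (1 + \<bar>h (X 1 \<omega>)\<bar> powr \<beta>)"
    using powr_le_one_plus_powr[of "\<bar>h (X 1 _)\<bar>" 1 \<beta>] \<beta>_gt by (intro AE_I2) simp
qed

lemma eventually_integrable_W:
  "\<forall>\<^sub>F n in sequentially. \<forall>j\<in>{1..n}. integrable M (W n j)"
  using W_moment
proof eventually_elim
  case (elim n)
  show ?case
  proof
    fix j assume j: "j \<in> {1..n}"
    have \<alpha>: "\<alpha> \<ge> 1" using \<alpha>_gt p_ge by linarith
    show "integrable M (W n j)"
    proof (rule Bochner_Integration.integrable_bound)
      show "integrable M (\<lambda>\<omega>. 1 + \<bar>W n j \<omega>\<bar> powr \<alpha>)" using elim j by auto
      show "random_variable borel (W n j)" by (rule W_measurable[OF j])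
      show "AE \<omega> in M. norm (W n j \<omega>) \<le> norm (1 + \<bar>W n j \<omega>\<bar> powr \<alpha>)"
        using powr_le_one_plus_powr[of "\<bar>W n j _\<bar>" 1 \<alpha>] \<alpha> by (intro AE_I2) simp
    qed
  qed
qed

lemma integral_W_times_X:
  fixes g :: "real \<Rightarrow> real" and h :: "'b \<Rightarrow> real"
  assumes j: "j \<in> {1..n}" and W: "integrable M (W n j)"
    and g: "g \<in> borel_measurable borel" "\<And>w. \<bar>g w\<bar> \<le> \<bar>w\<bar>"
    and h: "h \<in> borel_measurable borel" "integrable M (\<lambda>\<omega>. h (X 1 \<omega>))"
  shows "integrable M (\<lambda>\<omega>. g (W n j \<omega>) * h (X j \<omega>))"
    and "expectation (\<lambda>\<omega>. g (W n j \<omega>) * h (X j \<omega>)) =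
      expectation (\<lambda>\<omega>. g (W n j \<omega>)) * expectation (\<lambda>\<omega>. h (X 1 \<omega>))"
proof -
  note [measurable] = W_measurable[OF j] X_measurable[of 1, simplified] g(1) h(1)
  have j1: "j \<ge> 1" using j by simp
  have [measurable]: "random_variable borel (X j)" by (rule X_measurable[OF j1])
  have n: "n \<ge> 1" using j by simp
  have G: "(\<lambda>f. g (f j)) \<in> Pi\<^sub>M {1..n} (\<lambda>_. borel) \<rightarrow>\<^sub>M borel"
    by (rule measurable_compose[where f = "\<lambda>f. f j" and g = g]) (rule measurable_component_singleton[OF j], rule g(1))
  have H: "(\<lambda>f. h (f j)) \<in> Pi\<^sub>M {1..n} (\<lambda>_. borel) \<rightarrow>\<^sub>M borel"
    by (rule measurable_compose[where f = "\<lambda>f. f j" and g = h]) (rule measurable_component_singleton[OF j], rule h(1))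
  have "indep_var_het borel (\<lambda>\<omega>. g ((\<lambda>j\<in>{1..n}. W n j \<omega>) j)) borel (\<lambda>\<omega>. h ((\<lambda>j\<in>{1..n}. X j \<omega>) j))"
    by (rule indep_var_het_compose[OF W_X_indep[OF n] G H])
  then have ind: "indep_var borel (\<lambda>\<omega>. g (W n j \<omega>)) borel (\<lambda>\<omega>. h (X j \<omega>))"
    using j by (simp add: indep_var_het_eq_indep_var)
  have gint: "integrable M (\<lambda>\<omega>. g (W n j \<omega>))"
    using g(2) by (intro Bochner_Integration.integrable_bound[OF W]) auto
  have hj: "integrable M (\<lambda>\<omega>. h (X j \<omega>))" "expectation (\<lambda>\<omega>. h (X j \<omega>)) = expectation (\<lambda>\<omega>. h (X 1 \<omega>))"
    using integrable_distr_eq[of "X j" M borel h] integrable_distr_eq[of "X 1" M borel h]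
      integral_distr[of "X j" M borel h] integral_distr[of "X 1" M borel h] X_ident[OF j1] h(2)
    by simp_all
  show "integrable M (\<lambda>\<omega>. g (W n j \<omega>) * h (X j \<omega>))"
    by (rule indep_var_integrable[OF ind gint hj(1)])
  show "expectation (\<lambda>\<omega>. g (W n j \<omega>) * h (X j \<omega>)) =
      expectation (\<lambda>\<omega>. g (W n j \<omega>)) * expectation (\<lambda>\<omega>. h (X 1 \<omega>))"
    using indep_var_lebesgue_integral[OF ind gint hj(1)] hj(2) by simp
qed

definition centred_average :: "(real \<Rightarrow> real) \<Rightarrow> ('b \<Rightarrow> real) \<Rightarrow> nat \<Rightarrow> 'w \<Rightarrow> real" where
  "centred_average g h n \<omega> = 1 / real n powr (1 / p) *
    (\<Sum>j=1..n. g (W n j \<omega>) * h (X j \<omega>) - expectation (\<lambda>\<omega>. g (W n j \<omega>) * h (X j \<omega>)))"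

text \<open>The positive and negative parts of the weights enter through \<open>g\<close>; monotonicity keeps the rows NOD.\<close>

lemma one_sided_strong_law:
  assumes g: "mono g \<or> antimono g" "g \<in> borel_measurable borel" "\<And>w. 0 \<le> g w" "\<And>w. g w \<le> \<bar>w\<bar>"
    and h: "h \<in> borel_measurable borel" "\<And>z. 0 \<le> h z" "integrable M (\<lambda>\<omega>. h (X 1 \<omega>) powr \<beta>)"
  shows "AE \<omega> in M. (\<lambda>n. centred_average g h n \<omega>) \<longlonglongrightarrow> 0"
proof -
  interpret nonneg_weighted_array M "\<lambda>n j \<omega>. g (W n j \<omega>)" "\<lambda>j \<omega>. h (X j \<omega>)" p \<alpha> \<beta> A
  proof
    show "neg_orthant_dep (\<lambda>j \<omega>. g (W n j \<omega>)) {1..n}" if "n \<ge> 1" for n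
      using g(1) neg_orthant_dep_mono[OF W_nod[OF that], of "\<lambda>_. g"]
        neg_orthant_dep_antimono[OF W_nod[OF that], of "\<lambda>_. g"] g(2) by auto
    show "indep_vars (\<lambda>_. borel) (\<lambda>j \<omega>. h (X j \<omega>)) {1..}"
      using indep_vars_compose2[OF X_indep, of "\<lambda>_. h" "\<lambda>_. borel"] h(1) by simp
    show "distr M borel (\<lambda>\<omega>. h (X j \<omega>)) = distr M borel (\<lambda>\<omega>. h (X 1 \<omega>))" if "j \<ge> 1" for j
    proof -
      have "distr M borel (\<lambda>\<omega>. h (X j \<omega>)) = distr (distr M borel (X j)) borel h"
        using X_measurable[OF that] h(1) by (simp add: distr_distr comp_def)
      also have "\<dots> = distr M borel (\<lambda>\<omega>. h (X 1 \<omega>))"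
        using X_measurable[of 1] h(1) by (simp add: X_ident[OF that] distr_distr comp_def)
      finally show ?thesis .
    qed
    show "indep_var (Pi\<^sub>M {1..n} (\<lambda>_. borel)) (\<lambda>\<omega>. \<lambda>j\<in>{1..n}. h (X j \<omega>))
        (Pi\<^sub>M {1..n} (\<lambda>_. borel)) (\<lambda>\<omega>. \<lambda>j\<in>{1..n}. g (W n j \<omega>))" if "n \<ge> 1" for n
    proof -
      have G: "(\<lambda>f. \<lambda>j\<in>{1..n}. g (f j)) \<in> Pi\<^sub>M {1..n} (\<lambda>_. borel) \<rightarrow>\<^sub>M Pi\<^sub>M {1..n} (\<lambda>_. borel)"
        by (intro measurable_restrict measurable_compose[where g = g, OF _ g(2)] measurable_component_singleton)
      have H: "(\<lambda>f. \<lambda>j\<in>{1..n}. h (f j)) \<in> Pi\<^sub>M {1..n} (\<lambda>_. borel) \<rightarrow>\<^sub>M Pi\<^sub>M {1..n} (\<lambda>_. borel)"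
        by (intro measurable_restrict measurable_compose[where g = h, OF _ h(1)] measurable_component_singleton)
      have eq: "(\<lambda>j\<in>{1..n}. g ((\<lambda>j\<in>{1..n}. W n j \<omega>) j)) = (\<lambda>j\<in>{1..n}. g (W n j \<omega>))"
        "(\<lambda>j\<in>{1..n}. h ((\<lambda>j\<in>{1..n}. X j \<omega>) j)) = (\<lambda>j\<in>{1..n}. h (X j \<omega>))" for \<omega>
        by auto
      show ?thesis
        unfolding indep_var_het_eq_indep_var[symmetric]
        by (rule indep_var_het_swap[OF indep_var_het_compose[OF W_X_indep[OF that] G H, unfolded eq]])
    qed
    show "integrable M (\<lambda>\<omega>. h (X 1 \<omega>) powr \<beta>)" by (rule h(3))
    show "\<forall>\<^sub>F n in sequentially. (\<forall>j\<in>{1..n}. integrable M (\<lambda>\<omega>. g (W n j \<omega>) powr \<alpha>)) \<and>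
      (\<Sum>j=1..n. expectation (\<lambda>\<omega>. g (W n j \<omega>) powr \<alpha>)) \<le> A * real n"
      using W_moment
    proof eventually_elim
      case (elim n)
      have le: "g w powr \<alpha> \<le> \<bar>w\<bar> powr \<alpha>" for w
        using g(3,4) \<alpha>_gt p_ge by (intro powr_mono2) auto
      have int: "integrable M (\<lambda>\<omega>. g (W n j \<omega>) powr \<alpha>)" if j: "j \<in> {1..n}" for j
      proof (rule Bochner_Integration.integrable_bound)
        show "integrable M (\<lambda>\<omega>. \<bar>W n j \<omega>\<bar> powr \<alpha>)" using elim j by blast
        show "random_variable borel (\<lambda>\<omega>. g (W n j \<omega>) powr \<alpha>)"
          by (rule measurable_compose[OF measurable_compose[OF W_measurable[OF j] g(2)]]) measurable
      qed (use le in auto)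
      have "(\<Sum>j=1..n. expectation (\<lambda>\<omega>. g (W n j \<omega>) powr \<alpha>)) \<le> (\<Sum>j=1..n. expectation (\<lambda>\<omega>. \<bar>W n j \<omega>\<bar> powr \<alpha>))"
        using elim by (intro sum_mono integral_mono int le) auto
      then show ?case using int elim by auto
    qed
  qed (use g h p_ge p_less \<alpha>_gt \<beta>_gt exponents A_nonneg in auto)
  show ?thesis unfolding centred_average_def using weighted_strong_law by simp
qed

text \<open>The absolute value is not monotone, so \<open>\<bar>W n j\<bar>\<close> need not be NOD; it is the sum of the positive and
  the negative part, each of which obeys the one-sided law.\<close>

lemma strong_law_abs:
  assumes h: "h \<in> borel_measurable borel" "\<And>z. 0 \<le> h z" "integrable M (\<lambda>\<omega>. h (X 1 \<omega>) powr \<beta>)"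
  shows "AE \<omega> in M. (\<lambda>n. centred_average abs h n \<omega>) \<longlonglongrightarrow> 0"
proof -
  have h1: "integrable M (\<lambda>\<omega>. h (X 1 \<omega>))" using h by (intro integrable_X_powr_one[of h]) auto
  have pos: "AE \<omega> in M. (\<lambda>n. centred_average (\<lambda>w. max w 0) h n \<omega>) \<longlonglongrightarrow> 0"
    by (intro one_sided_strong_law[where h = h] h) (auto intro!: monoI)
  have neg: "AE \<omega> in M. (\<lambda>n. centred_average (\<lambda>w. max (- w) 0) h n \<omega>) \<longlonglongrightarrow> 0"
    by (intro one_sided_strong_law[where h = h] h) (auto intro!: antimonoI)
  have split: "\<forall>\<^sub>F n in sequentially. \<forall>\<omega>. centred_average abs h n \<omega> =
      centred_average (\<lambda>w. max w 0) h n \<omega> + centred_average (\<lambda>w. max (- w) 0) h n \<omega>"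
    using eventually_integrable_W
  proof eventually_elim
    case (elim n)
    have "\<bar>W n j \<omega>\<bar> * h (X j \<omega>) - expectation (\<lambda>\<omega>. \<bar>W n j \<omega>\<bar> * h (X j \<omega>)) =
        (max (W n j \<omega>) 0 * h (X j \<omega>) - expectation (\<lambda>\<omega>. max (W n j \<omega>) 0 * h (X j \<omega>))) +
        (max (- W n j \<omega>) 0 * h (X j \<omega>) - expectation (\<lambda>\<omega>. max (- W n j \<omega>) 0 * h (X j \<omega>)))"
      if j: "j \<in> {1..n}" for j \<omega>
    proof -
      have eq: "\<bar>w\<bar> * z = max w 0 * z + max (- w) 0 * z" for w z :: real by (auto simp: max_def)
      have "expectation (\<lambda>\<omega>. \<bar>W n j \<omega>\<bar> * h (X j \<omega>)) =
          expectation (\<lambda>\<omega>. max (W n j \<omega>) 0 * h (X j \<omega>)) + expectation (\<lambda>\<omega>. max (- W n j \<omega>) 0 * h (X j \<omega>))"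
        unfolding eq using elim j h(1) h1
        by (intro Bochner_Integration.integral_add
            integral_W_times_X(1)[OF j, where g = "\<lambda>w. max w 0" and h = h]
            integral_W_times_X(1)[OF j, where g = "\<lambda>w. max (- w) 0" and h = h]) auto
      then show ?thesis using eq[of "W n j \<omega>" "h (X j \<omega>)"] by linarith
    qed
    then show ?case
      unfolding centred_average_def distrib_left[symmetric] sum.distrib[symmetric]
      by (intro allI arg_cong2[where f = "(*)"] sum.cong refl) auto
  qed
  from pos neg show ?thesis
  proof eventually_elim
    case (elim \<omega>)
    have "\<forall>\<^sub>F n in sequentially. centred_average (\<lambda>w. max w 0) h n \<omega> + centred_average (\<lambda>w. max (- w) 0) h n \<omega> =
      centred_average abs h n \<omega>" using split by eventually_elim simp
    from tendsto_cong[OF this] tendsto_add[OF elim] show ?case by simp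
  qed
qed

lemma strong_law_signed:
  assumes h: "h \<in> borel_measurable borel" "integrable M (\<lambda>\<omega>. \<bar>h (X 1 \<omega>)\<bar> powr \<beta>)"
  shows "AE \<omega> in M. (\<lambda>n. centred_average (\<lambda>w. w) h n \<omega>) \<longlonglongrightarrow> 0"
proof -
  define hp where "hp = (\<lambda>z. max (h z) 0)"
  define hn where "hn = (\<lambda>z. max (- h z) 0)"
  note [measurable] = X_measurable[of 1, simplified] h(1)
  have parts: "k \<in> borel_measurable borel" "\<And>z. 0 \<le> k z" "integrable M (\<lambda>\<omega>. k (X 1 \<omega>) powr \<beta>)"
      "integrable M (\<lambda>\<omega>. k (X 1 \<omega>))" if k: "k = hp \<or> k = hn" for k
  proof -
    show 1: "k \<in> borel_measurable borel" using k unfolding hp_def hn_def by auto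
    show 2: "0 \<le> k z" for z using k by (auto simp: hp_def hn_def)
    have "k z powr \<beta> \<le> \<bar>h z\<bar> powr \<beta>" for z
      using k \<beta>_gt by (intro powr_mono2) (auto simp: hp_def hn_def)
    then show 3: "integrable M (\<lambda>\<omega>. k (X 1 \<omega>) powr \<beta>)"
      using 1 by (intro Bochner_Integration.integrable_bound[OF h(2)]) auto
    show "integrable M (\<lambda>\<omega>. k (X 1 \<omega>))" using 1 2 3 by (intro integrable_X_powr_one[of k]) auto
  qed
  have lim: "AE \<omega> in M. (\<lambda>n. centred_average g k n \<omega>) \<longlonglongrightarrow> 0"
    if "g = (\<lambda>w. max w 0) \<or> g = (\<lambda>w. max (- w) 0)" "k = hp \<or> k = hn" for g k
    using that(1) by (intro one_sided_strong_law[where h = k] parts[OF that(2)]) (auto intro!: antimonoI monoI)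
  let ?c = "\<lambda>n \<omega>. centred_average (\<lambda>w. max w 0) hp n \<omega> - centred_average (\<lambda>w. max w 0) hn n \<omega> -
    centred_average (\<lambda>w. max (- w) 0) hp n \<omega> + centred_average (\<lambda>w. max (- w) 0) hn n \<omega>"
  have split: "\<forall>\<^sub>F n in sequentially. \<forall>\<omega>. centred_average (\<lambda>w. w) h n \<omega> = ?c n \<omega>"
    using eventually_integrable_W
  proof eventually_elim
    case (elim n)
    let ?d = "\<lambda>g k j \<omega>. g (W n j \<omega>) * k (X j \<omega>) - expectation (\<lambda>\<omega>. g (W n j \<omega>) * k (X j \<omega>))"
    have "?d (\<lambda>w. w) h j \<omega> = ?d (\<lambda>w. max w 0) hp j \<omega> - ?d (\<lambda>w. max w 0) hn j \<omega> -
        ?d (\<lambda>w. max (- w) 0) hp j \<omega> + ?d (\<lambda>w. max (- w) 0) hn j \<omega>"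
      if j: "j \<in> {1..n}" for j \<omega>
    proof -
      have eq: "w * h z = max w 0 * hp z - max w 0 * hn z - max (- w) 0 * hp z + max (- w) 0 * hn z" for w z
        by (auto simp: max_def hp_def hn_def)
      have int: "integrable M (\<lambda>\<omega>. g (W n j \<omega>) * k (X j \<omega>))"
        if "g = (\<lambda>w. max w 0) \<or> g = (\<lambda>w. max (- w) 0)" "k = hp \<or> k = hn" for g k
        using elim j that(1) parts(1,4)[OF that(2)] by (intro integral_W_times_X(1)[OF j, where g = g and h = k]) auto
      have "expectation (\<lambda>\<omega>. W n j \<omega> * h (X j \<omega>)) =
          expectation (\<lambda>\<omega>. max (W n j \<omega>) 0 * hp (X j \<omega>)) - expectation (\<lambda>\<omega>. max (W n j \<omega>) 0 * hn (X j \<omega>)) -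
          expectation (\<lambda>\<omega>. max (- W n j \<omega>) 0 * hp (X j \<omega>)) + expectation (\<lambda>\<omega>. max (- W n j \<omega>) 0 * hn (X j \<omega>))"
        unfolding eq
        using int[of "\<lambda>w. max w 0" hp] int[of "\<lambda>w. max w 0" hn]
          int[of "\<lambda>w. max (- w) 0" hp] int[of "\<lambda>w. max (- w) 0" hn] by simp
      then show ?thesis using eq[of "W n j \<omega>" "X j \<omega>"] by linarith
    qed
    then show ?case
      unfolding centred_average_def distrib_left[symmetric] right_diff_distrib[symmetric]
        sum.distrib[symmetric] sum_subtractf[symmetric]
      by (intro allI arg_cong2[where f = "(*)"] sum.cong refl) auto
  qed
  have "AE \<omega> in M. (\<lambda>n. centred_average (\<lambda>w. max w 0) hp n \<omega>) \<longlonglongrightarrow> 0"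
    "AE \<omega> in M. (\<lambda>n. centred_average (\<lambda>w. max w 0) hn n \<omega>) \<longlonglongrightarrow> 0"
    "AE \<omega> in M. (\<lambda>n. centred_average (\<lambda>w. max (- w) 0) hp n \<omega>) \<longlonglongrightarrow> 0"
    "AE \<omega> in M. (\<lambda>n. centred_average (\<lambda>w. max (- w) 0) hn n \<omega>) \<longlonglongrightarrow> 0"
    by (rule lim; simp)+
  then show ?thesis
  proof eventually_elim
    case (elim \<omega>)
    have "\<forall>\<^sub>F n in sequentially. ?c n \<omega> = centred_average (\<lambda>w. w) h n \<omega>"
      using split by eventually_elim simp
    from tendsto_cong[OF this] tendsto_add[OF tendsto_diff[OF tendsto_diff[OF elim(1,2)] elim(3)] elim(4)]
    show ?case by simp
  qed
qed

end

section \<open>Suprema of continuous families over compact sets\<close>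

text \<open>Finite nets for the radii \<open>1 / Suc k\<close> together form a dense set.\<close>

lemma compact_countable_dense:
  fixes S :: "'a::metric_space set"
  assumes "compact S"
  shows "\<exists>T. countable T \<and> T \<subseteq> S \<and> S \<subseteq> closure T"
proof -
  have "\<forall>k::nat. \<exists>F. finite F \<and> F \<subseteq> S \<and> S \<subseteq> (\<Union>x\<in>F. ball x (1 / real (Suc k)))"
    using seq_compact_imp_totally_bounded[of S] assms by (simp add: compact_eq_seq_compact_metric)
  then obtain F where F: "\<And>k. finite (F k)" "\<And>k. F k \<subseteq> S"
      "\<And>k. S \<subseteq> (\<Union>x\<in>F k. ball x (1 / real (Suc k)))"
    by metis
  have "S \<subseteq> closure (\<Union>k. F k)"
  proof
    fix s assume s: "s \<in> S"
    show "s \<in> closure (\<Union>k. F k)"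
    proof (subst closure_approachable, intro allI impI)
      fix e :: real assume "e > 0"
      then obtain k where k: "1 / real (Suc k) < e" using nat_approx_posE by blast
      have "s \<in> (\<Union>x\<in>F k. ball x (1 / real (Suc k)))" using F(3) s by blast
      then obtain x where "x \<in> F k" "dist x s < 1 / real (Suc k)" unfolding UN_iff mem_ball by blast
      moreover from this(2) have "dist x s < e" using k by (rule order.strict_trans)
      ultimately show "\<exists>y\<in>\<Union>k. F k. dist y s < e" by blast
    qed
  qed
  moreover have "countable (\<Union>k. F k)" using F(1) by (intro countable_UN) (auto intro: countable_finite)
  ultimately show ?thesis using F(2) by (intro exI[of _ "\<Union>k. F k"]) auto
qed

lemma bdd_above_image_subset_compact:
  fixes f :: "'a::metric_space \<Rightarrow> real"
  assumes "compact S" "continuous_on S f" "T \<subseteq> S"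
  shows "bdd_above (f ` T)"
proof -
  have "bounded (f ` S)" using compact_imp_bounded[OF compact_continuous_image[OF assms(2,1)]] .
  then have "bdd_above (f ` S)" by (rule bounded_imp_bdd_above)
  then show ?thesis using assms(3) by (meson bdd_above_mono image_mono)
qed

text \<open>By continuity the supremum may be taken over a countable dense subset. Relative openness of the
  index set matters: it lets a dense subset of \<open>S\<close> approximate every index from within the set.\<close>

lemma borel_measurable_SUP_relatively_open:
  fixes f :: "'a::metric_space \<Rightarrow> 'b \<Rightarrow> real"
  assumes S: "compact S" and U: "open U" and ne: "S \<inter> U \<noteq> {}"
    and cont: "\<And>x. continuous_on S (\<lambda>\<theta>. f \<theta> x)"
    and meas: "\<And>\<theta>. \<theta> \<in> S \<Longrightarrow> f \<theta> \<in> borel_measurable N"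
  shows "(\<lambda>x. SUP \<theta>\<in>S \<inter> U. f \<theta> x) \<in> borel_measurable N"
proof -
  obtain T where T: "countable T" "T \<subseteq> S" "S \<subseteq> closure T"
    using compact_countable_dense[OF S] by blast
  have approx: "\<exists>t. (\<forall>k. t k \<in> T \<inter> U) \<and> t \<longlonglongrightarrow> \<theta>" if \<theta>: "\<theta> \<in> S \<inter> U" for \<theta>
  proof -
    have "\<theta> \<in> closure (T \<inter> U)"
      using open_Int_closure_subset[OF U, of T] \<theta> T(3) by (auto simp: Int_commute)
    then show ?thesis by (simp add: closure_sequential)
  qed
  have ne': "T \<inter> U \<noteq> {}" using ne approx by blast
  have bdd: "bdd_above ((\<lambda>\<theta>. f \<theta> x) ` R)" if "R \<subseteq> S" for R x
    by (rule bdd_above_image_subset_compact[OF S cont that])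
  have eq: "(SUP \<theta>\<in>S \<inter> U. f \<theta> x) = (SUP \<theta>\<in>T \<inter> U. f \<theta> x)" for x
  proof (rule antisym)
    show "(SUP \<theta>\<in>T \<inter> U. f \<theta> x) \<le> (SUP \<theta>\<in>S \<inter> U. f \<theta> x)"
      using T(2) ne' by (intro cSUP_subset_mono bdd) auto
    show "(SUP \<theta>\<in>S \<inter> U. f \<theta> x) \<le> (SUP \<theta>\<in>T \<inter> U. f \<theta> x)"
    proof (rule cSUP_least[OF ne])
      fix \<theta> assume \<theta>: "\<theta> \<in> S \<inter> U"
      from approx[OF this] obtain t where t: "\<And>k. t k \<in> T \<inter> U" "t \<longlonglongrightarrow> \<theta>" by blast
      have "(\<lambda>k. f (t k) x) \<longlonglongrightarrow> f \<theta> x"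
        using \<theta> t T(2) by (intro continuous_on_tendsto_compose[OF cont]) (auto intro!: always_eventually)
      then show "f \<theta> x \<le> (SUP \<theta>\<in>T \<inter> U. f \<theta> x)"
        using t(1) T(2) by (intro LIMSEQ_le_const2) (auto intro!: exI[of _ 0] cSUP_upper bdd)
    qed
  qed
  show ?thesis
    unfolding eq
  proof (rule borel_measurable_cSUP)
    show "bdd_above ((\<lambda>\<theta>. f \<theta> x) ` (T \<inter> U))" for x using T(2) by (intro bdd) auto
  qed (use T(1,2) meas in \<open>auto intro: countable_subset\<close>)
qed

locale continuous_family =
  fixes \<Theta> :: "'a::metric_space set" and H :: "'a \<Rightarrow> 'b::topological_space \<Rightarrow> real"
  assumes compact_index: "compact \<Theta>" and index_nonempty: "\<Theta> \<noteq> {}"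
    and continuous_index: "continuous_on \<Theta> (\<lambda>\<theta>. H \<theta> x)"
    and measurable_argument: "\<theta> \<in> \<Theta> \<Longrightarrow> H \<theta> \<in> borel_measurable borel"
begin

definition envelope :: "'b \<Rightarrow> real" where
  "envelope x = (SUP \<theta>\<in>\<Theta>. \<bar>H \<theta> x\<bar>)"

definition oscillation :: "'a \<Rightarrow> real \<Rightarrow> 'b \<Rightarrow> real" where
  "oscillation \<theta>0 r x = (SUP \<theta>\<in>\<Theta> \<inter> ball \<theta>0 r. \<bar>H \<theta> x - H \<theta>0 x\<bar>)"

lemma bdd_envelope: "bdd_above ((\<lambda>\<theta>. \<bar>H \<theta> x\<bar>) ` \<Theta>)"
  by (rule bdd_above_image_subset_compact[OF compact_index])
    (auto intro!: continuous_intros continuous_index)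

lemma bdd_oscillation: "bdd_above ((\<lambda>\<theta>. \<bar>H \<theta> x - H \<theta>0 x\<bar>) ` (\<Theta> \<inter> ball \<theta>0 r))"
  by (rule bdd_above_image_subset_compact[OF compact_index])
    (auto intro!: continuous_intros continuous_index)

lemma envelope_upper: "\<theta> \<in> \<Theta> \<Longrightarrow> \<bar>H \<theta> x\<bar> \<le> envelope x"
  unfolding envelope_def by (rule cSUP_upper[OF _ bdd_envelope])

lemma oscillation_upper:
  "\<theta> \<in> \<Theta> \<Longrightarrow> dist \<theta>0 \<theta> < r \<Longrightarrow> \<bar>H \<theta> x - H \<theta>0 x\<bar> \<le> oscillation \<theta>0 r x"
  unfolding oscillation_def by (rule cSUP_upper[OF _ bdd_oscillation]) simp

lemma oscillation_nonneg: "\<theta>0 \<in> \<Theta> \<Longrightarrow> r > 0 \<Longrightarrow> 0 \<le> oscillation \<theta>0 r x"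
  using oscillation_upper[of \<theta>0 \<theta>0 r x] by simp

lemma oscillation_least:
  assumes "\<theta>0 \<in> \<Theta>" "r > 0" "\<And>\<theta>. \<theta> \<in> \<Theta> \<Longrightarrow> dist \<theta>0 \<theta> < r \<Longrightarrow> \<bar>H \<theta> x - H \<theta>0 x\<bar> \<le> c"
  shows "oscillation \<theta>0 r x \<le> c"
  unfolding oscillation_def
proof (rule cSUP_least)
  show "\<Theta> \<inter> ball \<theta>0 r \<noteq> {}" using assms(1,2) by (auto intro!: exI[of _ \<theta>0])
qed (use assms(3) in auto)

lemma oscillation_le_envelope:
  assumes "\<theta>0 \<in> \<Theta>" "r > 0"
  shows "oscillation \<theta>0 r x \<le> 2 * envelope x"
proof (rule oscillation_least[OF assms])
  fix \<theta> assume "\<theta> \<in> \<Theta>"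
  then show "\<bar>H \<theta> x - H \<theta>0 x\<bar> \<le> 2 * envelope x"
    using envelope_upper[of \<theta> x] envelope_upper[OF assms(1), of x] by linarith
qed

lemma envelope_measurable [measurable]: "envelope \<in> borel_measurable borel"
proof -
  have "(\<lambda>x. SUP \<theta>\<in>\<Theta> \<inter> UNIV. \<bar>H \<theta> x\<bar>) \<in> borel_measurable borel"
    using index_nonempty measurable_argument
    by (intro borel_measurable_SUP_relatively_open[OF compact_index])
      (auto intro!: continuous_intros continuous_index)
  then show ?thesis by (simp add: envelope_def[abs_def])
qed

lemma oscillation_measurable:
  assumes "\<theta>0 \<in> \<Theta>" "r > 0"
  shows "oscillation \<theta>0 r \<in> borel_measurable borel"
proof -
  have "(\<lambda>x. SUP \<theta>\<in>\<Theta> \<inter> ball \<theta>0 r. \<bar>H \<theta> x - H \<theta>0 x\<bar>) \<in> borel_measurable borel"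
    using measurable_argument assms
    by (intro borel_measurable_SUP_relatively_open[OF compact_index])
      (auto intro!: continuous_intros continuous_index exI[of _ \<theta>0])
  then show ?thesis by (simp add: oscillation_def[abs_def])
qed

text \<open>This is pointwise continuity of the family at \<open>\<theta>0\<close>.\<close>

lemma oscillation_tendsto_0:
  assumes \<theta>0: "\<theta>0 \<in> \<Theta>"
  shows "(\<lambda>k. oscillation \<theta>0 (1 / real (Suc k)) x) \<longlonglongrightarrow> 0"
proof (rule tendstoI)
  fix e :: real assume e: "e > 0"
  have "\<exists>d>0. \<forall>\<theta>\<in>\<Theta>. dist \<theta> \<theta>0 < d \<longrightarrow> dist (H \<theta> x) (H \<theta>0 x) < e / 2"
    using continuous_index[of x] \<theta>0 half_gt_zero[OF e] unfolding continuous_on_iff by blast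
  then obtain d where d: "d > 0" "\<And>\<theta>. \<theta> \<in> \<Theta> \<Longrightarrow> dist \<theta> \<theta>0 < d \<Longrightarrow> dist (H \<theta> x) (H \<theta>0 x) < e / 2"
    by blast
  have "(\<lambda>k. 1 / real (Suc k)) \<longlonglongrightarrow> 0" by (rule LIMSEQ_Suc[OF lim_1_over_n])
  then have "\<forall>\<^sub>F k in sequentially. 1 / real (Suc k) < d" using d(1) by (rule order_tendstoD(2))
  then show "\<forall>\<^sub>F k in sequentially. dist (oscillation \<theta>0 (1 / real (Suc k)) x) 0 < e"
  proof eventually_elim
    case (elim k)
    have "oscillation \<theta>0 (1 / real (Suc k)) x \<le> e / 2"
    proof (rule oscillation_least[OF \<theta>0])
      fix \<theta> assume "\<theta> \<in> \<Theta>" "dist \<theta>0 \<theta> < 1 / real (Suc k)"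
      then have "dist (H \<theta> x) (H \<theta>0 x) < e / 2"
        using elim by (intro d(2)) (simp_all add: dist_commute)
      then show "\<bar>H \<theta> x - H \<theta>0 x\<bar> \<le> e / 2" unfolding dist_real_def by linarith
    qed simp
    then show ?case using e oscillation_nonneg[OF \<theta>0, of "1 / real (Suc k)" x] by simp
  qed
qed

text \<open>The envelope is attained, so its power occurs among the terms of the supremum.\<close>

lemma envelope_powr_le_SUP:
  "ennreal (envelope x powr \<beta>) \<le> (SUP \<theta>\<in>\<Theta>. ennreal (\<bar>H \<theta> x\<bar> powr \<beta>))"
proof -
  have "\<exists>\<theta>\<in>\<Theta>. \<forall>\<theta>'\<in>\<Theta>. \<bar>H \<theta>' x\<bar> \<le> \<bar>H \<theta> x\<bar>"
    by (rule continuous_attains_sup[OF compact_index index_nonempty])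
      (auto intro!: continuous_intros continuous_index)
  then obtain \<theta> where \<theta>: "\<theta> \<in> \<Theta>" "\<And>\<theta>'. \<theta>' \<in> \<Theta> \<Longrightarrow> \<bar>H \<theta>' x\<bar> \<le> \<bar>H \<theta> x\<bar>" by blast
  have "envelope x = \<bar>H \<theta> x\<bar>"
    unfolding envelope_def using \<theta> by (intro cSup_eq_maximum) auto
  then show ?thesis using \<theta>(1) by (auto intro: SUP_upper2)
qed

end

section \<open>The uniform strong law\<close>

locale nod_weighted_family = nod_weighted_sample M W X p \<alpha> \<beta> A B + continuous_family \<Theta> H
  for M :: "'w measure" and W :: "nat \<Rightarrow> nat \<Rightarrow> 'w \<Rightarrow> real" and X :: "nat \<Rightarrow> 'w \<Rightarrow> 'b::topological_space"
    and p \<alpha> \<beta> A B :: real and \<Theta> :: "'a::metric_space set" and H :: "'a \<Rightarrow> 'b \<Rightarrow> real" +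
  assumes envelope_moment: "integrable M (\<lambda>\<omega>. envelope (X 1 \<omega>) powr \<beta>)"
begin

lemma X1_measurable [measurable]: "random_variable borel (X 1)" "random_variable borel (X (Suc 0))"
  using X_measurable[of 1] by simp_all

lemma H_moment:
  assumes "\<theta> \<in> \<Theta>"
  shows "integrable M (\<lambda>\<omega>. \<bar>H \<theta> (X 1 \<omega>)\<bar> powr \<beta>)"
proof (rule Bochner_Integration.integrable_bound[OF envelope_moment])
  note [measurable] = measurable_argument[OF assms]
  show "(\<lambda>\<omega>. \<bar>H \<theta> (X 1 \<omega>)\<bar> powr \<beta>) \<in> borel_measurable M" by measurable
  have "\<bar>H \<theta> z\<bar> powr \<beta> \<le> envelope z powr \<beta>" for z
    using envelope_upper[OF assms, of z] \<beta>_gt by (intro powr_mono2) auto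
  then show "AE \<omega> in M. norm (\<bar>H \<theta> (X 1 \<omega>)\<bar> powr \<beta>) \<le> norm (envelope (X 1 \<omega>) powr \<beta>)" by simp
qed

lemma envelope_nonneg: "0 \<le> envelope z"
  using envelope_upper[of _ z] index_nonempty by (metis abs_ge_zero all_not_in_conv order_trans)

lemma oscillation_moment:
  assumes "\<theta>0 \<in> \<Theta>" "r > 0"
  shows "integrable M (\<lambda>\<omega>. oscillation \<theta>0 r (X 1 \<omega>) powr \<beta>)"
proof (rule Bochner_Integration.integrable_bound)
  note [measurable] = oscillation_measurable[OF assms]
  show "integrable M (\<lambda>\<omega>. 2 powr \<beta> * envelope (X 1 \<omega>) powr \<beta>)"
    using envelope_moment by simp
  show "(\<lambda>\<omega>. oscillation \<theta>0 r (X 1 \<omega>) powr \<beta>) \<in> borel_measurable M" by measurable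
  have "oscillation \<theta>0 r z powr \<beta> \<le> 2 powr \<beta> * envelope z powr \<beta>" for z
  proof -
    have "oscillation \<theta>0 r z powr \<beta> \<le> (2 * envelope z) powr \<beta>"
      using oscillation_le_envelope[OF assms] oscillation_nonneg[OF assms] \<beta>_gt by (intro powr_mono2) auto
    then show ?thesis using envelope_nonneg by (simp add: powr_mult)
  qed
  then show "AE \<omega> in M. norm (oscillation \<theta>0 r (X 1 \<omega>) powr \<beta>) \<le> norm (2 powr \<beta> * envelope (X 1 \<omega>) powr \<beta>)"
    by simp
qed

lemma small_mean_oscillation:
  assumes \<theta>0: "\<theta>0 \<in> \<Theta>" and \<epsilon>: "\<epsilon> > 0"
  shows "\<exists>r>0. expectation (\<lambda>\<omega>. oscillation \<theta>0 r (X 1 \<omega>)) < \<epsilon>"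
proof -
  let ?r = "\<lambda>k. 1 / real (Suc k)"
  have [measurable]: "oscillation \<theta>0 (?r k) \<in> borel_measurable borel" for k
    using \<theta>0 by (intro oscillation_measurable) auto
  have env: "integrable M (\<lambda>\<omega>. envelope (X 1 \<omega>))"
    using envelope_moment envelope_nonneg by (intro integrable_X_powr_one[of envelope]) auto
  have "(\<lambda>k. expectation (\<lambda>\<omega>. oscillation \<theta>0 (?r k) (X 1 \<omega>))) \<longlonglongrightarrow> expectation (\<lambda>\<omega>. 0)"
  proof (rule integral_dominated_convergence[where w = "\<lambda>\<omega>. 2 * envelope (X 1 \<omega>)"])
    show "AE \<omega> in M. (\<lambda>k. oscillation \<theta>0 (?r k) (X 1 \<omega>)) \<longlonglongrightarrow> 0"
      by (intro AE_I2 oscillation_tendsto_0[OF \<theta>0])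
    show "AE \<omega> in M. norm (oscillation \<theta>0 (?r k) (X 1 \<omega>)) \<le> 2 * envelope (X 1 \<omega>)" for k
      using oscillation_le_envelope[OF \<theta>0, of "?r k"] oscillation_nonneg[OF \<theta>0, of "?r k"]
      by (intro AE_I2) simp
    show "random_variable borel (\<lambda>\<omega>. oscillation \<theta>0 (?r k) (X 1 \<omega>))" for k by measurable
  qed (use env in auto)
  then have "\<forall>\<^sub>F k in sequentially. expectation (\<lambda>\<omega>. oscillation \<theta>0 (?r k) (X 1 \<omega>)) < \<epsilon>"
    by (rule order_tendstoD(2)) (use \<epsilon> in simp)
  then obtain k where "expectation (\<lambda>\<omega>. oscillation \<theta>0 (?r k) (X 1 \<omega>)) < \<epsilon>"
    by (auto simp: eventually_sequentially)
  then show ?thesis by (intro exI[of _ "?r k"]) simp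
qed

text \<open>Replacing \<open>\<theta>\<close> by \<open>\<theta>0\<close> costs at most \<open>\<bar>W n j\<bar>\<close> times the oscillation, both in the sum and in
  its mean. Centring the random cost leaves two copies of its mean, which by independence is a
  product and is controlled by \<open>W_mean\<close>.\<close>

lemma centred_average_transfer:
  assumes n: "n \<ge> 1" and W: "\<And>j. j \<in> {1..n} \<Longrightarrow> integrable M (W n j)"
    and mean: "(\<Sum>j=1..n. expectation (\<lambda>\<omega>. \<bar>W n j \<omega>\<bar>)) \<le> B * real n powr (1 / p)"
    and \<theta>: "\<theta>0 \<in> \<Theta>" "\<theta> \<in> \<Theta>" "r > 0" "dist \<theta>0 \<theta> < r"
  shows "\<bar>centred_average (\<lambda>w. w) (H \<theta>) n \<omega>\<bar> \<le> \<bar>centred_average (\<lambda>w. w) (H \<theta>0) n \<omega>\<bar> +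
    centred_average abs (oscillation \<theta>0 r) n \<omega> + 2 * B * expectation (\<lambda>\<omega>. oscillation \<theta>0 r (X 1 \<omega>))"
proof -
  define D where "D = oscillation \<theta>0 r"
  define m where "m = expectation (\<lambda>\<omega>. D (X 1 \<omega>))"
  define N where "N = real n powr (1 / p)"
  have N: "N > 0" using n by (simp add: N_def)
  have D: "D \<in> borel_measurable borel" "\<And>z. 0 \<le> D z"
    using oscillation_measurable oscillation_nonneg \<theta> by (auto simp: D_def)
  have Dint: "integrable M (\<lambda>\<omega>. D (X 1 \<omega>))"
    using D oscillation_moment[OF \<theta>(1,3)] by (intro integrable_X_powr_one[of D]) (auto simp: D_def)
  have m: "m \<ge> 0" unfolding m_def using D(2) by (intro integral_nonneg_AE) auto
  have Hint: "integrable M (\<lambda>\<omega>. H \<theta>' (X 1 \<omega>))" if "\<theta>' \<in> \<Theta>" for \<theta>'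
    using measurable_argument[OF that] H_moment[OF that] by (intro integrable_X_powr_one[of "H \<theta>'"])
  let ?d = "\<lambda>\<theta>' j. W n j \<omega> * H \<theta>' (X j \<omega>) - expectation (\<lambda>\<omega>. W n j \<omega> * H \<theta>' (X j \<omega>))"
  let ?e = "\<lambda>j. \<bar>W n j \<omega>\<bar> * D (X j \<omega>) - expectation (\<lambda>\<omega>. \<bar>W n j \<omega>\<bar> * D (X j \<omega>))"
  have diff: "\<bar>?d \<theta> j - ?d \<theta>0 j\<bar> \<le> ?e j + 2 * m * expectation (\<lambda>\<omega>. \<bar>W n j \<omega>\<bar>)" if j: "j \<in> {1..n}" for j
  proof -
    have int: "integrable M (\<lambda>\<omega>. W n j \<omega> * H \<theta>' (X j \<omega>))" if "\<theta>' \<in> \<Theta>" for \<theta>'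
      using integral_W_times_X(1)[OF j W[OF j], where g = "\<lambda>w. w" and h = "H \<theta>'"]
        measurable_argument[OF that] Hint[OF that] by simp
    have intD: "integrable M (\<lambda>\<omega>. \<bar>W n j \<omega>\<bar> * D (X j \<omega>))"
        "expectation (\<lambda>\<omega>. \<bar>W n j \<omega>\<bar> * D (X j \<omega>)) = expectation (\<lambda>\<omega>. \<bar>W n j \<omega>\<bar>) * m"
      using integral_W_times_X[OF j W[OF j], where g = abs and h = D] D Dint by (simp_all add: m_def)
    have le: "\<bar>W n j \<omega>' * H \<theta> (X j \<omega>') - W n j \<omega>' * H \<theta>0 (X j \<omega>')\<bar> \<le> \<bar>W n j \<omega>'\<bar> * D (X j \<omega>')" for \<omega>'
      unfolding right_diff_distrib[symmetric] abs_mult D_def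
      by (intro mult_left_mono oscillation_upper \<theta>) simp
    have "\<bar>expectation (\<lambda>\<omega>. W n j \<omega> * H \<theta> (X j \<omega>)) - expectation (\<lambda>\<omega>. W n j \<omega> * H \<theta>0 (X j \<omega>))\<bar> =
        \<bar>expectation (\<lambda>\<omega>. W n j \<omega> * H \<theta> (X j \<omega>) - W n j \<omega> * H \<theta>0 (X j \<omega>))\<bar>"
      using int \<theta> by simp
    also have "\<dots> \<le> expectation (\<lambda>\<omega>. \<bar>W n j \<omega> * H \<theta> (X j \<omega>) - W n j \<omega> * H \<theta>0 (X j \<omega>)\<bar>)"
      by (rule integral_abs_bound)
    also have "\<dots> \<le> expectation (\<lambda>\<omega>. \<bar>W n j \<omega>\<bar> * D (X j \<omega>))"
      using int \<theta> by (intro integral_mono intD le) auto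
    finally show ?thesis using le[of \<omega>] intD(2) by (simp add: mult.commute)
  qed
  have "\<bar>\<Sum>j=1..n. ?d \<theta> j\<bar> \<le> \<bar>\<Sum>j=1..n. ?d \<theta>0 j\<bar> + \<bar>\<Sum>j=1..n. ?d \<theta> j - ?d \<theta>0 j\<bar>"
    by (simp only: sum_subtractf)
  also have "\<bar>\<Sum>j=1..n. ?d \<theta> j - ?d \<theta>0 j\<bar> \<le> (\<Sum>j=1..n. ?e j + 2 * m * expectation (\<lambda>\<omega>. \<bar>W n j \<omega>\<bar>))"
    by (rule order_trans[OF sum_abs sum_mono]) (rule diff)
  also have "\<dots> = (\<Sum>j=1..n. ?e j) + 2 * m * (\<Sum>j=1..n. expectation (\<lambda>\<omega>. \<bar>W n j \<omega>\<bar>))"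
    by (simp only: sum.distrib sum_distrib_left)
  also have "\<dots> \<le> (\<Sum>j=1..n. ?e j) + 2 * m * (B * N)"
    using mean m by (intro add_left_mono mult_left_mono) (auto simp: N_def)
  finally have "1 / N * \<bar>\<Sum>j=1..n. ?d \<theta> j\<bar> \<le> 1 / N * (\<bar>\<Sum>j=1..n. ?d \<theta>0 j\<bar> + ((\<Sum>j=1..n. ?e j) + 2 * m * (B * N)))"
    using N by (intro mult_left_mono) auto
  also have "\<dots> = 1 / N * \<bar>\<Sum>j=1..n. ?d \<theta>0 j\<bar> + 1 / N * (\<Sum>j=1..n. ?e j) + 2 * B * m"
    using N by (simp add: field_simps)
  finally show ?thesis
    unfolding centred_average_def D_def[symmetric] m_def[symmetric] N_def[symmetric] abs_mult
    using N by simp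
qed

lemma uniform_eventually_le:
  assumes \<epsilon>: "\<epsilon> > 0"
  shows "AE \<omega> in M. \<forall>\<^sub>F n in sequentially. \<forall>\<theta>\<in>\<Theta>.
    \<bar>centred_average (\<lambda>w. w) (H \<theta>) n \<omega>\<bar> \<le> (2 + 2 * B) * \<epsilon>"
proof -
  have "\<forall>\<theta>0. \<exists>r. \<theta>0 \<in> \<Theta> \<longrightarrow> r > 0 \<and> expectation (\<lambda>\<omega>. oscillation \<theta>0 r (X 1 \<omega>)) < \<epsilon>"
    using small_mean_oscillation[OF _ \<epsilon>] by blast
  then obtain r where r: "\<And>\<theta>0. \<theta>0 \<in> \<Theta> \<Longrightarrow> r \<theta>0 > 0"
      "\<And>\<theta>0. \<theta>0 \<in> \<Theta> \<Longrightarrow> expectation (\<lambda>\<omega>. oscillation \<theta>0 (r \<theta>0) (X 1 \<omega>)) < \<epsilon>"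
    by metis
  obtain F where F: "F \<subseteq> \<Theta>" "finite F" "\<Theta> \<subseteq> (\<Union>\<theta>0\<in>F. ball \<theta>0 (r \<theta>0))"
    by (rule compactE_image[OF compact_index, of \<Theta> "\<lambda>\<theta>0. ball \<theta>0 (r \<theta>0)"]) (use r(1) in auto)
  have "AE \<omega> in M. \<forall>\<theta>0\<in>F. (\<lambda>n. centred_average (\<lambda>w. w) (H \<theta>0) n \<omega>) \<longlonglongrightarrow> 0"
    unfolding AE_finite_all[OF F(2)]
    using F(1) by (intro ballI strong_law_signed measurable_argument H_moment) auto
  moreover have "AE \<omega> in M. \<forall>\<theta>0\<in>F. (\<lambda>n. centred_average abs (oscillation \<theta>0 (r \<theta>0)) n \<omega>) \<longlonglongrightarrow> 0"
    unfolding AE_finite_all[OF F(2)]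
  proof
    fix \<theta>0 assume "\<theta>0 \<in> F"
    then have \<theta>0: "\<theta>0 \<in> \<Theta>" using F(1) by blast
    note * = \<theta>0 r(1)[OF \<theta>0]
    show "AE \<omega> in M. (\<lambda>n. centred_average abs (oscillation \<theta>0 (r \<theta>0)) n \<omega>) \<longlonglongrightarrow> 0"
      by (rule strong_law_abs[OF oscillation_measurable[OF *] oscillation_nonneg[OF *] oscillation_moment[OF *]])
  qed
  ultimately show ?thesis
  proof eventually_elim
    case (elim \<omega>)
    have "\<forall>\<^sub>F n in sequentially. \<forall>\<theta>0\<in>F. \<bar>centred_average (\<lambda>w. w) (H \<theta>0) n \<omega>\<bar> < \<epsilon>"
      using tendstoD[OF elim(1)[rule_format] \<epsilon>]
      by (intro eventually_ball_finite F(2)) (simp add: dist_real_def)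
    moreover have "\<forall>\<^sub>F n in sequentially. \<forall>\<theta>0\<in>F. \<bar>centred_average abs (oscillation \<theta>0 (r \<theta>0)) n \<omega>\<bar> < \<epsilon>"
      using tendstoD[OF elim(2)[rule_format] \<epsilon>]
      by (intro eventually_ball_finite F(2)) (simp add: dist_real_def)
    ultimately show ?case
      using eventually_integrable_W W_mean eventually_ge_at_top[of 1]
    proof eventually_elim
      case (elim n)
      show ?case
      proof
        fix \<theta> assume \<theta>: "\<theta> \<in> \<Theta>"
        then obtain \<theta>0 where \<theta>0: "\<theta>0 \<in> F" "dist \<theta>0 \<theta> < r \<theta>0" using F(3) by auto
        then have \<theta>0': "\<theta>0 \<in> \<Theta>" using F(1) by blast
        have "2 * B * expectation (\<lambda>\<omega>. oscillation \<theta>0 (r \<theta>0) (X 1 \<omega>)) \<le> 2 * B * \<epsilon>"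
          using r(2)[OF \<theta>0'] B_nonneg by (intro mult_left_mono) auto
        moreover have "\<bar>centred_average (\<lambda>w. w) (H \<theta>) n \<omega>\<bar> \<le> \<bar>centred_average (\<lambda>w. w) (H \<theta>0) n \<omega>\<bar> +
            centred_average abs (oscillation \<theta>0 (r \<theta>0)) n \<omega> + 2 * B * expectation (\<lambda>\<omega>. oscillation \<theta>0 (r \<theta>0) (X 1 \<omega>))"
          using elim by (intro centred_average_transfer \<theta>0' \<theta> r(1) \<theta>0(2)) auto
        ultimately show "\<bar>centred_average (\<lambda>w. w) (H \<theta>) n \<omega>\<bar> \<le> (2 + 2 * B) * \<epsilon>"
          using bspec[OF elim(1) \<theta>0(1)] bspec[OF elim(2) \<theta>0(1)] by (simp add: algebra_simps)
      qed
    qed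
  qed
qed

lemma uniform_strong_law:
  "AE \<omega> in M. (\<lambda>n. SUP \<theta>\<in>\<Theta>. ennreal \<bar>centred_average (\<lambda>w. w) (H \<theta>) n \<omega>\<bar>) \<longlonglongrightarrow> 0"
proof -
  have "AE \<omega> in M. \<forall>k::nat. \<forall>\<^sub>F n in sequentially. \<forall>\<theta>\<in>\<Theta>.
    \<bar>centred_average (\<lambda>w. w) (H \<theta>) n \<omega>\<bar> \<le> (2 + 2 * B) * (1 / real (Suc k))"
    unfolding AE_all_countable by (intro allI uniform_eventually_le) simp
  then show ?thesis
  proof eventually_elim
    case (elim \<omega>)
    show ?case
    proof (rule order_tendstoI)
      fix a :: ennreal assume a: "0 < a"
      have "\<exists>e>0. ennreal e < a"
      proof -
        obtain b where b: "0 < b" "b < a" using dense[OF a] by blast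
        then have "b < top" by (simp add: order.strict_trans2)
        then show ?thesis using b by (cases b) (auto simp: ennreal_less_zero_iff)
      qed
      then obtain e where e: "e > 0" "ennreal e < a" by blast
      have "0 < e / (2 + 2 * B)" using e(1) B_nonneg by simp
      then obtain k where "1 / real (Suc k) < e / (2 + 2 * B)" by (rule nat_approx_posE)
      then have k: "(2 + 2 * B) * (1 / real (Suc k)) \<le> e"
        using B_nonneg by (simp add: pos_less_divide_eq mult.commute)
      show "\<forall>\<^sub>F n in sequentially. (SUP \<theta>\<in>\<Theta>. ennreal \<bar>centred_average (\<lambda>w. w) (H \<theta>) n \<omega>\<bar>) < a"
        using elim[rule_format, of k]
      proof eventually_elim
        case (elim n)
        have "(SUP \<theta>\<in>\<Theta>. ennreal \<bar>centred_average (\<lambda>w. w) (H \<theta>) n \<omega>\<bar>) \<le> ennreal e"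
          by (intro SUP_least ennreal_leI order_trans[OF bspec[OF elim] k])
        then show ?case using e(2) by (rule order.strict_trans1)
      qed
    qed simp
  qed
qed

end

text \<open>An extended-valued bound holding for all large \<open>n\<close> makes the moments in question finite there, so
  they become ordinary integrals.\<close>

lemma (in prob_space) ennreal_bigo_moments:
  assumes O: "ennreal_bigo (\<lambda>n. \<Sum>j=1..n. \<integral>\<^sup>+\<omega>. ennreal (f n j \<omega>) \<partial>M) g"
    and f: "\<And>n j. j \<in> {1..n} \<Longrightarrow> random_variable borel (f n j)" "\<And>n j \<omega>. 0 \<le> f n j \<omega>"
    and g: "\<And>n. 0 \<le> g n"
  shows "\<exists>C\<ge>0. \<forall>\<^sub>F n in sequentially. (\<forall>j\<in>{1..n}. integrable M (f n j)) \<and>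
    (\<Sum>j=1..n. expectation (f n j)) \<le> C * g n"
proof -
  obtain C where C: "\<forall>\<^sub>F n in sequentially. (\<Sum>j=1..n. \<integral>\<^sup>+\<omega>. ennreal (f n j \<omega>) \<partial>M) \<le> ennreal (C * \<bar>g n\<bar>)"
    using O by (auto simp: ennreal_bigo_def)
  have "\<forall>\<^sub>F n in sequentially. (\<forall>j\<in>{1..n}. integrable M (f n j)) \<and>
    (\<Sum>j=1..n. expectation (f n j)) \<le> \<bar>C\<bar> * g n"
    using C
  proof eventually_elim
    case (elim n)
    have int: "integrable M (f n j)" if j: "j \<in> {1..n}" for j
    proof (rule integrableI_nonneg)
      have "(\<integral>\<^sup>+\<omega>. ennreal (f n j \<omega>) \<partial>M) \<le> (\<Sum>j=1..n. \<integral>\<^sup>+\<omega>. ennreal (f n j \<omega>) \<partial>M)"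
        using j by (intro member_le_sum) auto
      also have "\<dots> \<le> ennreal (C * \<bar>g n\<bar>)" by (rule elim)
      finally show "(\<integral>\<^sup>+\<omega>. ennreal (f n j \<omega>) \<partial>M) < \<infinity>" by (simp add: le_less_trans)
    qed (use f j in auto)
    have "ennreal (\<Sum>j=1..n. expectation (f n j)) = (\<Sum>j=1..n. \<integral>\<^sup>+\<omega>. ennreal (f n j \<omega>) \<partial>M)"
      using f(2) by (subst sum_ennreal[symmetric]) (auto simp: nn_integral_eq_integral[OF int])
    also have "\<dots> \<le> ennreal (C * \<bar>g n\<bar>)" by (rule elim)
    also have "\<dots> \<le> ennreal (\<bar>C\<bar> * g n)" using g[of n] by (intro ennreal_leI mult_mono) auto
    finally have "(\<Sum>j=1..n. expectation (f n j)) \<le> \<bar>C\<bar> * g n"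
      using g[of n] by (subst (asm) ennreal_le_iff) auto
    then show ?case using int by blast
  qed
  then show ?thesis by (intro exI[of _ "\<bar>C\<bar>"]) simp
qed

theorem theorem2:
  fixes M :: "'w measure"
    and \<Theta> :: "'a::metric_space set"
    and H :: "'a \<Rightarrow> real ^ 'u \<Rightarrow> real"
    and X :: "nat \<Rightarrow> 'w \<Rightarrow> real ^ 'u"
    and W :: "nat \<Rightarrow> nat \<Rightarrow> 'w \<Rightarrow> real"
    and p \<alpha> \<beta> :: real
  assumes "prob_space M"
    and "separable_space (euclidean :: 'a topology)"
    and "compact \<Theta>"
    and "\<And>x. continuous_on \<Theta> (\<lambda>\<theta>. H \<theta> x)"
    and "\<And>\<theta>. \<theta> \<in> \<Theta> \<Longrightarrow> H \<theta> \<in> borel_measurable borel"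
    and "prob_space.indep_vars M (\<lambda>_. borel) X {1..}"
    and "\<And>j. j \<ge> 1 \<Longrightarrow> distr M borel (X j) = distr M borel (X 1)"
    and "\<And>n. n \<ge> 1 \<Longrightarrow> prob_space.neg_orthant_dep M (W n) {1..n}"
    and "prob_space.indep_vars M
           (\<lambda>n. Pi\<^sub>M {1..n} (\<lambda>_. borel)) (\<lambda>n \<omega>. \<lambda>j\<in>{1..n}. W n j \<omega>) {1..}"
    and "prob_space.indep_var_het M
           (Pi\<^sub>M {1..} (\<lambda>n. Pi\<^sub>M {1..n} (\<lambda>_. borel))) (\<lambda>\<omega>. \<lambda>n\<in>{1..}. \<lambda>j\<in>{1..n}. W n j \<omega>)
           (Pi\<^sub>M {1..} (\<lambda>_. borel)) (\<lambda>\<omega>. \<lambda>j\<in>{1..}. X j \<omega>)"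
    and "1 \<le> p" "p < 2"
    and "\<alpha> > 2 * p" "\<beta> > 1" "1 / \<alpha> + 1 / \<beta> = 1 / p"
    and "(\<integral>\<^sup>+ \<omega>. (SUP \<theta>\<in>\<Theta>. ennreal (\<bar>H \<theta> (X 1 \<omega>)\<bar> powr \<beta>)) \<partial>M) < \<infinity>"
    and "ennreal_bigo (\<lambda>n. \<Sum>j=1..n. \<integral>\<^sup>+ \<omega>. ennreal (\<bar>W n j \<omega>\<bar> powr \<alpha>) \<partial>M) (\<lambda>n. real n)"
    and "ennreal_bigo (\<lambda>n. \<Sum>j=1..n. \<integral>\<^sup>+ \<omega>. ennreal \<bar>W n j \<omega>\<bar> \<partial>M) (\<lambda>n. real n powr (1 / p))"
  shows "AE \<omega> in M.
    (\<lambda>n. SUP \<theta>\<in>\<Theta>. ennreal \<bar>1 / real n powr (1 / p) *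
        (\<Sum>j=1..n. (W n j \<omega> * H \<theta> (X j \<omega>) - (\<integral>\<omega>'. W n j \<omega>' * H \<theta> (X j \<omega>') \<partial>M)))\<bar>)
      \<longlonglongrightarrow> 0"
proof (cases "\<Theta> = {}")
  case True
  then show ?thesis by (simp add: bot_ennreal)
next
  case False
  interpret prob_space M by fact
  have W_meas: "random_variable borel (W n j)" if "j \<in> {1..n}" for n j
    using neg_orthant_depD(2)[OF assms(8), of n j] that by auto
  have rows: "indep_var_het (Pi\<^sub>M {1..n} (\<lambda>_. borel)) (\<lambda>\<omega>. \<lambda>j\<in>{1..n}. W n j \<omega>)
      (Pi\<^sub>M {1..n} (\<lambda>_. borel)) (\<lambda>\<omega>. \<lambda>j\<in>{1..n}. X j \<omega>)" if n: "n \<ge> 1" for n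
  proof -
    have 1: "(\<lambda>f. f n) \<in> Pi\<^sub>M {1..} (\<lambda>n. Pi\<^sub>M {1..n} (\<lambda>_. borel :: real measure)) \<rightarrow>\<^sub>M Pi\<^sub>M {1..n} (\<lambda>_. borel)"
      using n by (intro measurable_component_singleton) simp
    have 2: "(\<lambda>f. restrict f {1..n}) \<in> Pi\<^sub>M {1..} (\<lambda>_. borel :: (real ^ 'u) measure) \<rightarrow>\<^sub>M Pi\<^sub>M {1..n} (\<lambda>_. borel)"
      by (intro measurable_restrict_subset) auto
    have eq: "restrict (\<lambda>j\<in>{1..}. X j \<omega>) {1..n} = (\<lambda>j\<in>{1..n}. X j \<omega>)"
      "(\<lambda>n\<in>{1..}. \<lambda>j\<in>{1..n}. W n j \<omega>) n = (\<lambda>j\<in>{1..n}. W n j \<omega>)" for \<omega>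
      using n by (auto simp: restrict_def)
    show ?thesis
      using indep_var_het_compose[OF assms(10) 1 2] unfolding eq .
  qed
  obtain A where A: "A \<ge> 0" "\<forall>\<^sub>F n in sequentially. (\<forall>j\<in>{1..n}. integrable M (\<lambda>\<omega>. \<bar>W n j \<omega>\<bar> powr \<alpha>)) \<and>
      (\<Sum>j=1..n. expectation (\<lambda>\<omega>. \<bar>W n j \<omega>\<bar> powr \<alpha>)) \<le> A * real n"
    using ennreal_bigo_moments[OF assms(17)] W_meas by auto
  obtain B where B: "B \<ge> 0" "\<forall>\<^sub>F n in sequentially. (\<forall>j\<in>{1..n}. integrable M (\<lambda>\<omega>. \<bar>W n j \<omega>\<bar>)) \<and>
      (\<Sum>j=1..n. expectation (\<lambda>\<omega>. \<bar>W n j \<omega>\<bar>)) \<le> B * real n powr (1 / p)"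
    using ennreal_bigo_moments[OF assms(18)] W_meas by auto
  interpret continuous_family \<Theta> H
    by unfold_locales (use assms(3,4,5) False in auto)
  have [measurable]: "random_variable borel (X 1)"
    using assms(6) by (auto simp: indep_vars_def)
  have moment: "integrable M (\<lambda>\<omega>. envelope (X 1 \<omega>) powr \<beta>)"
  proof (rule integrableI_nonneg)
    have "(\<integral>\<^sup>+\<omega>. ennreal (envelope (X 1 \<omega>) powr \<beta>) \<partial>M)
        \<le> (\<integral>\<^sup>+\<omega>. (SUP \<theta>\<in>\<Theta>. ennreal (\<bar>H \<theta> (X 1 \<omega>)\<bar> powr \<beta>)) \<partial>M)"
      by (intro nn_integral_mono envelope_powr_le_SUP)
    also have "\<dots> < \<infinity>" by (rule assms(16))
    finally show "(\<integral>\<^sup>+\<omega>. ennreal (envelope (X 1 \<omega>) powr \<beta>) \<partial>M) < \<infinity>" .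
    show "random_variable borel (\<lambda>\<omega>. envelope (X 1 \<omega>) powr \<beta>)" by measurable
  qed simp
  interpret nod_weighted_family M W X p \<alpha> \<beta> A B \<Theta> H
  proof
    show "\<forall>\<^sub>F n in sequentially. (\<Sum>j=1..n. expectation (\<lambda>\<omega>. \<bar>W n j \<omega>\<bar>)) \<le> B * real n powr (1 / p)"
      using B(2) by eventually_elim blast
  qed (fact assms rows A B(1) moment)+
  show ?thesis using uniform_strong_law unfolding centred_average_def .
qed

end
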